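(* Let $a,b,q$ be nonnegative integers with $a<b$, $2\le b$, $1\le q\le b$, let $p>0$ be a real number, and let $$f(x,y)=x^a y^b+x^a y^{b-q}e^{-1/|x|^p}.$$ Let $U$ be an open neighborhood of the origin in $\mathbb{R}^2$ and let $\varphi$ be a real-valued $C^\infty$ function with compact support contained in $U$. Assume that $q$ is even. Then the following hold. (i) If $p>1-a/b$, then $$\lim_{\sigma\to-1/b+0}(b\sigma+1)^{1-\frac{1-a/b}{p}}\cdot Z_f(\varphi)(\sigma)=4A\cdot\varphi(0,0),$$ where $A$ is the positive constant defined by the convergent improper integral $$A=\int_0^{\infty}x^{-a/b}\bigl(1-e^{-1/(qx^p)}\bigr)\,dx.$$ (ii) If $p=1-a/b$, then $$\lim_{\sigma\to-1/b+0}|\log(b\sigma+1)|^{-1}\cdot Z_f(\varphi)(\sigma)=\frac{4}{pq}\cdot\varphi(0,0).$$ (iii) If $0<p<1-a/b$, then there exists a constant $B(\varphi)$, which depends on $a,b,p,q,\varphi$ but is independent of $\sigma$, such that $$\lim_{\sigma\to-1/b+0}Z_f(\varphi)(\sigma)=B(\varphi),$$ and $B(\varphi)$ is positive if $\varphi$ satisfies $\varphi(0,0)>0$ and $\varphi(x,y)\ge 0$ on $U$.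
   Context: The function $e^{-1/|x|^p}$ is regarded as a $C^\infty$ function on $\mathbb{R}$ by giving it the value $0$ at $x=0$. Zeroth powers $x^0,y^0$ are the constant $1$. The local zeta function is $$Z_f(\varphi)(s)=\int_{\mathbb{R}^2}|f(x,y)|^s\varphi(x,y)\,dx\,dy .$$ The limits are taken with $\sigma$ real, $\sigma$ decreasing to $-1/b$, $\sigma\in(-1/b,0)$; for such $\sigma$ the integral $Z_f(\varphi)(\sigma)$ converges absolutely. *)

theory Defs
  imports "HOL-Analysis.Analysis"
begin

text \<open>
  \<open>Ck k f\<close>: all iterated directional derivatives of \<open>f\<close> of order below \<open>k\<close> are Frechet
  differentiable everywhere, and those of order \<open>k\<close> are continuous, i.e. \<open>f\<close> is of class
  $C^k$ on the whole space.
\<close>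

primrec Ck :: "nat \<Rightarrow> ('a::euclidean_space \<Rightarrow> real) \<Rightarrow> bool" where
  "Ck 0 f \<longleftrightarrow> continuous_on UNIV f"
| "Ck (Suc k) f \<longleftrightarrow>
     (\<forall>z. f differentiable (at z)) \<and> (\<forall>v. Ck k (\<lambda>z. frechet_derivative f (at z) v))"

definition Cinfinity :: "('a::euclidean_space \<Rightarrow> real) \<Rightarrow> bool" where
  "Cinfinity f \<longleftrightarrow> (\<forall>k. Ck k f)"

definition func_support :: "('a::topological_space \<Rightarrow> real) \<Rightarrow> 'a set" where
  "func_support f = closure {z. f z \<noteq> 0}"

text \<open>
  The function $e^{-1/|x|^p}$ extended by the value 0 at the origin. The case distinction is
  needed: in HOL the bare formula would evaluate to \<open>exp 0 = 1\<close> at \<open>x = 0\<close>.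
\<close>

definition flat_exp :: "real \<Rightarrow> real \<Rightarrow> real" where
  "flat_exp p x = (if x = 0 then 0 else exp (- 1 / \<bar>x\<bar> powr p))"

definition flat_f :: "nat \<Rightarrow> nat \<Rightarrow> nat \<Rightarrow> real \<Rightarrow> real \<times> real \<Rightarrow> real" where
  "flat_f a b q p = (\<lambda>(x, y). x ^ a * y ^ b + x ^ a * y ^ (b - q) * flat_exp p x)"

text \<open>
  The local zeta function at a real argument. For negative \<open>s\<close> the integrand is taken to be 0
  on the zero set of \<open>f\<close> because \<open>0 powr s = 0\<close>; for the functions \<open>flat_f\<close> this set is null.
\<close>

definition zeta_integrand ::
  "(real \<times> real \<Rightarrow> real) \<Rightarrow> (real \<times> real \<Rightarrow> real) \<Rightarrow> real \<Rightarrow> real \<times> real \<Rightarrow> real" where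
  "zeta_integrand f \<phi> s z = \<bar>f z\<bar> powr s * \<phi> z"

definition local_zeta ::
  "(real \<times> real \<Rightarrow> real) \<Rightarrow> (real \<times> real \<Rightarrow> real) \<Rightarrow> real \<Rightarrow> real" where
  "local_zeta f \<phi> s = (LINT z|lborel. zeta_integrand f \<phi> s z)"

definition A_integrand :: "nat \<Rightarrow> nat \<Rightarrow> nat \<Rightarrow> real \<Rightarrow> real \<Rightarrow> real" where
  "A_integrand a b q p x =
     x powr (- real a / real b) * (1 - exp (- 1 / (real q * x powr p)))"

text \<open>
  The integrand is nonnegative on \<open>{0<..}\<close>, so convergence of the improper integral is the
  same as Lebesgue integrability.
\<close>

definition A_const :: "nat \<Rightarrow> nat \<Rightarrow> nat \<Rightarrow> real \<Rightarrow> real" where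
  "A_const a b q p = (LINT x:{0<..}|lborel. A_integrand a b q p x)"

end

theory Submission
  imports Defs
begin

text \<open>
  Since \<open>q\<close> is even, $|f| = |x|^a |y|^{b-q} (|y|^q + w(x)^q)$ with $w(x) = e^{-1/(q|x|^p)}$, so $|f|^\sigma$
  behaves like $|x|^{a\sigma} |y|^{b\sigma}$ for $|y| > w(x)$, while $|y| \le w(x)$ contributes little.
  Replacing $|f|^\sigma \varphi(x,y)$ by $|x|^{a\sigma} |y|^{b\sigma} \varphi(x,0)$ on $w(x) < |y| \le 1$ costs an
  error with an integrable majorant that does not depend on $\sigma$; near the curve $|y| = w(x)$ this
  majorant is a fixed integrable profile rescaled by $w(x)$. With $d = b\sigma + 1$ the $y$-integral of the
  replacement is $2(1 - w(x)^d)/d$, and $x = d^{1/p} t$ turns the remaining integral into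
  $2\, d^{(1-a/b)/p - 1 + (a/b)d/p} \int |t|^{a\sigma} \varphi(d^{1/p}t, 0) (1 - e^{-1/(q|t|^p)})\, dt$.
  For $p > 1 - a/b$ dominated convergence applies. For $p = 1 - a/b$ the integrand is close to
  $\varphi(0,0)/(q|t|)$ on $1 < |t| \le d^{-1/p}$, which produces the logarithm. For $p < 1 - a/b$ already
  $|f|^{-1/b} \varphi$ is integrable.
\<close>

text \<open>The obstacle is uniformity in sigma while w(x) decays faster than every power of x as x
  tends to 0. Distances from the axis are therefore measured by |y|/w(x), and the error near the
  curve gets a majorant homogeneous of degree -1 in (y, w(x)), whose integral over y does not depend
  on w(x). As d tends to 0, (1 - w(x)^d)/d tends to -log w(x) = 1/(q|x|^p), and integrability of
  |x|^(-a/b-p) at 0 separates the three cases. The substitution x = d^(1/p) t is forced by w(d^(1/p)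
  t)^d = w(t). In the first two cases the normalising factor tends to 0, so a bounded error is
  harmless. In 4A one factor 2 comes from the symmetry in y and the other from the symmetry in x. In
  4/(pq) the same two factors meet 1/q, the coefficient of |t|^(-p) in 1 - w(t) at infinity, and
  1/p, from log d^(-1/p) = |log d|/p. The factor d^((a/b)d/p) tends to 1.\<close>

section \<open>Integrals of even functions on the line\<close>

lemma not_AE_notin_open:
  fixes S :: "'a::euclidean_space set"
  assumes S: "open S" "S \<noteq> {}"
  shows "\<not> (AE x in lborel. x \<notin> S)"
proof
  assume "AE x in lborel. x \<notin> S"
  then have "S \<in> null_sets lborel"
    using S by (subst AE_iff_null_sets) (auto simp: borel_open)
  then have "negligible S"
    by (simp add: negligible_iff_null_sets null_sets_completionI)
  then show False using open_not_negligible[OF S] by simp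
qed

text \<open>Adds the reflection of the integrand to itself. As \<open>S\<close> lies in the closed
  half-line, the two copies overlap at most at 0, a null set.\<close>

lemma has_bochner_integral_even:
  fixes h :: "real \<Rightarrow> real"
  assumes b1: "has_bochner_integral lborel (\<lambda>x. h x * indicator S x) I"
    and S: "S \<subseteq> {0..}" and [measurable]: "S \<in> sets borel" "h \<in> borel_measurable borel"
  shows "has_bochner_integral lborel (\<lambda>y. h \<bar>y\<bar> * indicator S \<bar>y\<bar>) (2 * I)"
proof -
  let ?g = "\<lambda>x. h x * indicator S x"
  have b2: "has_bochner_integral lborel (\<lambda>x. ?g (- x)) I"
    using lborel_has_bochner_integral_real_affine_iff[of "-1" ?g I 0] b1 by simp
  have b3: "has_bochner_integral lborel (\<lambda>x. ?g x + ?g (- x)) (2 * I)"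
    using has_bochner_integral_add[OF b1 b2] by simp
  have "AE x::real in lborel. x \<noteq> 0" by (rule AE_lborel_singleton)
  then have ae: "AE x in lborel. ?g x + ?g (- x) = h \<bar>x\<bar> * indicator S \<bar>x\<bar>"
    by eventually_elim (use S in \<open>auto simp: indicator_def abs_if\<close>)
  show ?thesis
    by (rule has_bochner_integralI_AE[OF b3 _ ae]) measurable
qed

text \<open>An antiderivative yields the Henstock-Kurzweil integral; nonnegativity makes its value
  the Lebesgue integral as well.\<close>

lemma has_bochner_integral_even_HK:
  fixes h :: "real \<Rightarrow> real"
  assumes "(h has_integral I) S" and S: "S \<subseteq> {0..}" and [measurable]: "S \<in> sets borel"
    and [measurable]: "h \<in> borel_measurable borel" and nonneg: "\<And>x. x \<in> S \<Longrightarrow> 0 \<le> h x"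
  shows "has_bochner_integral lborel (\<lambda>y. h \<bar>y\<bar> * indicator S \<bar>y\<bar>) (2 * I)"
proof (rule has_bochner_integral_even)
  let ?g = "\<lambda>x. h x * indicator S x"
  have g0: "?g x \<ge> 0" for x using nonneg by (auto simp: indicator_def)
  have hi: "(?g has_integral I) UNIV"
    using assms(1) has_integral_restrict_UNIV[of S h I]
    by (auto simp: indicator_def of_bool_def if_distrib cong: if_cong)
  have I0: "I \<ge> 0" using has_integral_nonneg[OF assms(1)] nonneg by auto
  have "integral\<^sup>N lborel ?g = I"
    by (rule nn_integral_has_integral_lborel[OF _ g0 hi]) measurable
  then show "has_bochner_integral lborel ?g I"
    using g0 I0 by (intro has_bochner_integral_nn_integral) auto
qed (use S in auto)

lemma has_bochner_integral_abs_powr_le: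
  fixes s r :: real
  assumes "s > -1" "r \<ge> 0"
  shows "has_bochner_integral lborel (\<lambda>y. \<bar>y\<bar> powr s * indicator {0..r} \<bar>y\<bar>) (2 * (r powr (s+1) / (s+1)))"
  using assms by (intro has_bochner_integral_even_HK has_integral_powr_from_0) auto

lemma has_bochner_integral_abs_powr_ge:
  fixes s r :: real
  assumes "s < -1" "r > 0"
  shows "has_bochner_integral lborel (\<lambda>y. \<bar>y\<bar> powr s * indicator {r..} \<bar>y\<bar>) (2 * (-(r powr (s+1)) / (s+1)))"
  using assms by (intro has_bochner_integral_even_HK has_integral_powr_to_inf) auto

lemma has_bochner_integral_abs_powr_Ioc:
  fixes s r t :: real
  assumes "s > -1" "0 < r" "r \<le> t"
  shows "has_bochner_integral lborel (\<lambda>y. \<bar>y\<bar> powr s * indicator {r<..t} \<bar>y\<bar>) (2 * ((t powr (s+1) - r powr (s+1)) / (s+1)))"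
proof -
  have "((\<lambda>x. x powr s) has_integral (t powr (s+1) / (s+1) - r powr (s+1) / (s+1))) {r..t}"
    using assms
    by (intro fundamental_theorem_of_calculus)
       (auto intro!: derivative_eq_intros simp: has_real_derivative_iff_has_vector_derivative [symmetric] )
  then have "((\<lambda>x. x powr s) has_integral ((t powr (s+1) - r powr (s+1)) / (s+1))) {r<..t}"
    by (subst has_integral_spike_set_eq[of _ "{r..t}"])
       (auto intro: negligible_subset[of "{r}"] simp: diff_divide_distrib)
  then show ?thesis
    using assms by (intro has_bochner_integral_even_HK) auto
qed

lemma has_bochner_integral_abs_inverse_Ioc:
  fixes r t :: real
  assumes "0 < r" "r \<le> t"
  shows "has_bochner_integral lborel (\<lambda>y. inverse \<bar>y\<bar> * indicator {r<..t} \<bar>y\<bar>) (2 * (ln t - ln r))"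
proof -
  have "(inverse has_integral (ln t - ln r)) {r..t}"
    using assms
    by (intro fundamental_theorem_of_calculus)
       (auto intro!: derivative_eq_intros simp: has_real_derivative_iff_has_vector_derivative [symmetric] divide_inverse)
  then have "(inverse has_integral (ln t - ln r)) {r<..t}"
    by (subst has_integral_spike_set_eq[of _ "{r..t}"])
       (auto intro: negligible_subset[of "{r}"])
  then show ?thesis
    using assms by (intro has_bochner_integral_even_HK) auto
qed

section \<open>Iterated integrals on the plane and limits under the integral\<close>

lemma AE_lborel_prod_nonzero: "AE z::real \<times> real in lborel. fst z \<noteq> 0 \<and> snd z \<noteq> 0"
proof -
  have "negligible {z::real \<times> real. (1,0) \<bullet> z = 0}" "negligible {z::real \<times> real. (0,1) \<bullet> z = 0}"
    by (rule negligible_hyperplane; simp add: zero_prod_def)+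
  moreover have "closed {z::real \<times> real. (1,0) \<bullet> z = 0}" "closed {z::real \<times> real. (0,1) \<bullet> z = 0}"
    by (rule closed_hyperplane)+
  ultimately have "{z::real \<times> real. (1,0) \<bullet> z = 0} \<in> null_sets lborel"
     "{z::real \<times> real. (0,1) \<bullet> z = 0} \<in> null_sets lborel"
    by (auto simp: negligible_iff_null_sets null_sets_completion_iff)
  from AE_not_in[OF this(1)] AE_not_in[OF this(2)]
  show ?thesis by eventually_elim (auto simp: inner_prod_def)
qed

text \<open>Tonelli with explicit slice integrals. The slice over x = 0 is exempt because that line
  is null and \<open>threshold 0\<close> will have the artificial value 1.\<close>

lemma integrable_lborel_prodI:
  fixes F :: "real \<times> real \<Rightarrow> real"
  assumes [measurable]: "F \<in> borel_measurable borel" and nonneg: "\<And>z. 0 \<le> F z"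
    and inner: "\<And>x. x \<noteq> 0 \<Longrightarrow> has_bochner_integral lborel (\<lambda>y. F (x, y)) (u x)"
    and u: "integrable lborel u"
  shows "integrable lborel F"
proof (rule integrableI_nonneg)
  have "(\<integral>\<^sup>+z. F z \<partial>lborel) = (\<integral>\<^sup>+z. F z \<partial>(lborel \<Otimes>\<^sub>M lborel))"
    by (simp add: lborel_prod)
  also have "\<dots> = (\<integral>\<^sup>+x. \<integral>\<^sup>+y. F (x, y) \<partial>lborel \<partial>lborel)"
    by (subst lborel.nn_integral_fst) (auto simp: lborel_prod)
  also have "\<dots> \<le> (\<integral>\<^sup>+x. ennreal (u x) \<partial>lborel)"
  proof (rule nn_integral_mono_AE)
    show "AE x in lborel. (\<integral>\<^sup>+y. F (x, y) \<partial>lborel) \<le> ennreal (u x)"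
      using AE_lborel_singleton[of "0::real"]
    proof eventually_elim
      case (elim x)
      then show ?case
        using inner[of x] nonneg by (auto simp: has_bochner_integral_iff nn_integral_eq_integral)
    qed
  qed
  also have "\<dots> < \<infinity>"
    using u by (auto simp: integrable_iff_bounded intro: le_less_trans[OF nn_integral_mono[OF ennreal_leI[OF abs_ge_self]]])
  finally show "(\<integral>\<^sup>+z. F z \<partial>lborel) < \<infinity>" .
qed (use nonneg in auto)

lemma integral_lborel_prod:
  fixes F :: "real \<times> real \<Rightarrow> real"
  assumes F: "integrable lborel F"
    and inner: "\<And>x. x \<noteq> 0 \<Longrightarrow> has_bochner_integral lborel (\<lambda>y. F (x, y)) (u x)"
    and [measurable]: "u \<in> borel_measurable borel"
  shows "(\<integral>z. F z \<partial>lborel) = (\<integral>x. u x \<partial>lborel)"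
proof -
  have [measurable]: "F \<in> borel_measurable borel" using F by auto
  have "(\<integral>z. F z \<partial>lborel) = (\<integral>x. (\<integral>y. F (x, y) \<partial>lborel) \<partial>lborel)"
    using lborel_pair.integral_fst'[of F] F by (simp add: lborel_prod)
  also have "\<dots> = (\<integral>x. u x \<partial>lborel)"
  proof (rule integral_cong_AE)
    show "(\<lambda>x. \<integral>y. F (x, y) \<partial>lborel) \<in> borel_measurable lborel"
      by (intro lborel.borel_measurable_lebesgue_integral) (simp add: lborel_prod)
    show "AE x in lborel. (\<integral>y. F (x, y) \<partial>lborel) = u x"
      using AE_lborel_singleton[of "0::real"]
      by eventually_elim (use inner in \<open>auto simp: has_bochner_integral_iff\<close>)
  qed auto
  finally show ?thesis .
qed

text \<open>A one-sided limit can be tested along sequences, which reduces it to dominated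
  convergence; the majorant has to hold on an interval to the right of \<open>c\<close>.\<close>

lemma tendsto_integral_at_right:
  fixes F :: "real \<Rightarrow> 'a::euclidean_space \<Rightarrow> real"
  assumes "c < d"
    and meas: "\<And>s. F s \<in> borel_measurable borel" "G \<in> borel_measurable borel"
    and W: "integrable lborel W"
    and bound: "\<And>s. c < s \<Longrightarrow> s < d \<Longrightarrow> AE x in lborel. \<bar>F s x\<bar> \<le> W x"
    and lim: "AE x in lborel. ((\<lambda>s. F s x) \<longlongrightarrow> G x) (at_right c)"
  shows "((\<lambda>s. \<integral>x. F s x \<partial>lborel) \<longlongrightarrow> (\<integral>x. G x \<partial>lborel)) (at_right c)"
proof (rule tendsto_at_right_sequentially[OF \<open>c < d\<close>])
  fix S :: "nat \<Rightarrow> real"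
  assume S: "\<And>n. c < S n" "\<And>n. S n < d" "S \<longlonglongrightarrow> c"
  then have S': "filterlim S (at_right c) sequentially"
    by (auto simp: filterlim_at intro: always_eventually)
  show "(\<lambda>n. \<integral>x. F (S n) x \<partial>lborel) \<longlonglongrightarrow> (\<integral>x. G x \<partial>lborel)"
  proof (rule integral_dominated_convergence[where w = W])
    show "AE x in lborel. (\<lambda>n. F (S n) x) \<longlonglongrightarrow> G x"
      using lim by eventually_elim (rule filterlim_compose[OF _ S'])
    show "AE x in lborel. norm (F (S n) x) \<le> W x" for n
      using bound[OF S(1,2)] by simp
  qed (use meas W in auto)
qed

section \<open>Elementary inequalities and one-sided limits\<close>

text \<open>The power lies between (1 + t)^(-1), which is at least 1 - t, and 1. Later
  \<open>t\<close> is the ratio of the two terms of f in absolute value, and it matters that the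
  linear bound is uniform in \<open>s\<close>.\<close>

lemma one_plus_powr_bounds:
  fixes s t :: real
  assumes "-1 \<le> s" "s \<le> 0" "0 \<le> t"
  shows "1 - t \<le> (1 + t) powr s" "(1 + t) powr s \<le> 1"
proof -
  have "1 - t \<le> (1 + t) powr (-1)"
    using assms by (simp add: powr_minus field_simps)
  also have "\<dots> \<le> (1 + t) powr s"
    using assms by (intro powr_mono) auto
  finally show "1 - t \<le> (1 + t) powr s" .
  show "(1 + t) powr s \<le> 1"
    using powr_mono[of s 0 "1 + t"] assms by simp
qed

text \<open>Transfers a limit from the model \<open>M\<close> to \<open>Z\<close>: a factor
  \<open>u\<close> that tends to 0 absorbs every bounded difference.\<close>

lemma tendsto_mult_bounded_diff:
  fixes u Z M :: "'a \<Rightarrow> real"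
  assumes "((\<lambda>s. u s * M s) \<longlongrightarrow> l) F" "(u \<longlongrightarrow> 0) F" "eventually (\<lambda>s. \<bar>Z s - M s\<bar> \<le> K) F"
  shows "((\<lambda>s. u s * Z s) \<longlongrightarrow> l) F"
proof -
  have "((\<lambda>s. u s * (Z s - M s)) \<longlongrightarrow> 0) F"
  proof (rule Lim_null_comparison)
    show "\<forall>\<^sub>F s in F. norm (u s * (Z s - M s)) \<le> \<bar>u s\<bar> * K"
      using assms(3) by eventually_elim (auto simp: abs_mult intro: mult_left_mono)
    show "((\<lambda>s. \<bar>u s\<bar> * K) \<longlongrightarrow> 0) F"
      using tendsto_mult_left_zero[OF tendsto_rabs_zero[OF assms(2)], of K] by simp
  qed
  from tendsto_add[OF assms(1) this] show ?thesis by (simp add: algebra_simps)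
qed

lemma tendsto_mult_ln_at_right_0: "((\<lambda>x::real. x * ln x) \<longlongrightarrow> 0) (at_right 0)"
proof -
  have "((\<lambda>x::real. - (ln (inverse x) / inverse x)) \<longlongrightarrow> - 0) (at_right 0)"
    by (intro tendsto_minus filterlim_compose[OF ln_x_over_x_tendsto_0 filterlim_inverse_at_top_right])
  moreover have "\<forall>\<^sub>F x::real in at_right 0. - (ln (inverse x) / inverse x) = x * ln x"
    using eventually_at_right_less[of 0] by eventually_elim (simp add: ln_inverse divide_inverse)
  ultimately show ?thesis by (simp add: tendsto_cong)
qed

text \<open>Deals with a power of d whose exponent is itself a multiple of d, a leftover of the
  rescaling in x.\<close>

lemma tendsto_powr_mult_at_right_0: "((\<lambda>x::real. x powr (k * x)) \<longlongrightarrow> 1) (at_right 0)"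
proof -
  have "((\<lambda>x::real. exp (k * (x * ln x))) \<longlongrightarrow> exp (k * 0)) (at_right 0)"
    by (intro tendsto_intros tendsto_mult_ln_at_right_0)
  moreover have "\<forall>\<^sub>F x::real in at_right 0. exp (k * (x * ln x)) = x powr (k * x)"
    using eventually_at_right_less[of 0] by eventually_elim (simp add: powr_def)
  ultimately show ?thesis by (simp add: tendsto_cong)
qed

lemma tendsto_inverse_abs_ln_at_right_0: "((\<lambda>x::real. inverse \<bar>ln x\<bar>) \<longlongrightarrow> 0) (at_right 0)"
proof -
  have "filterlim (\<lambda>x::real. - ln x) at_top (at_right 0)"
    using ln_at_0 by (simp add: filterlim_uminus_at_top)
  from tendsto_rabs_zero[OF tendsto_inverse_0_at_top[OF this]] show ?thesis by simp
qed

section \<open>Smooth functions with compact support\<close>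

lemma continuous_zero_outside_compact_bounded:
  fixes g :: "'a::euclidean_space \<Rightarrow> real"
  assumes "continuous_on UNIV g" "compact K" "\<And>z. z \<notin> K \<Longrightarrow> g z = 0"
  shows "\<exists>B\<ge>0. \<forall>z. \<bar>g z\<bar> \<le> B"
proof -
  have "compact (g ` K)"
    using assms by (intro compact_continuous_image continuous_on_subset[OF assms(1)]) auto
  then obtain B where B: "\<And>z. z \<in> K \<Longrightarrow> \<bar>g z\<bar> \<le> B"
    using compact_imp_bounded[of "g ` K"] by (auto simp: bounded_real)
  have "\<bar>g z\<bar> \<le> max B 0" for z
    using B[of z] assms(3)[of z] by (cases "z \<in> K") auto
  then show ?thesis by (intro exI[of _ "max B 0"]) auto
qed

lemma func_support_zero: "z \<notin> func_support f \<Longrightarrow> f z = 0"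
  using closure_subset[of "{z. f z \<noteq> 0}"] by (auto simp: func_support_def)

text \<open>\<open>Ck\<close> speaks of directional derivatives. Each is continuous and vanishes off
  the support, hence is bounded; the bounds over \<open>Basis\<close> sum to a bound for the
  operator norm of the derivative, and the mean value inequality does the rest.\<close>

lemma C1_compact_support_Lipschitz:
  fixes f :: "'a::euclidean_space \<Rightarrow> real"
  assumes Ck: "Ck (Suc 0) f" and K: "compact (func_support f)"
  shows "\<exists>B\<ge>0. \<forall>z z'. \<bar>f z - f z'\<bar> \<le> B * norm (z - z')"
proof -
  let ?D = "\<lambda>z. frechet_derivative f (at z)"
  have der: "(f has_derivative ?D z) (at z)" for z
    using Ck by (simp add: frechet_derivative_works)
  have cont: "continuous_on UNIV (\<lambda>z. ?D z v)" for v
    using Ck by simp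
  have "?D z v = 0" if "z \<notin> func_support f" for z v
  proof -
    have op: "open (- func_support f)" by (simp add: func_support_def open_Compl)
    have "((\<lambda>_. 0) has_derivative (\<lambda>_. 0)) (at z)" by simp
    then have "(f has_derivative (\<lambda>_. 0)) (at z)"
      by (rule has_derivative_transform_within_open[OF _ op])
         (use that in \<open>simp_all only: Compl_iff func_support_zero simp_thms\<close>)
    from has_derivative_unique[OF der this] show ?thesis by simp
  qed
  then have "\<forall>v. \<exists>B\<ge>0. \<forall>z. \<bar>?D z v\<bar> \<le> B"
    using continuous_zero_outside_compact_bounded[OF cont K] by auto
  then obtain B where B: "\<And>v. 0 \<le> B v" "\<And>v z. \<bar>?D z v\<bar> \<le> B v" by metis
  have on: "onorm (?D z) \<le> (\<Sum>i\<in>Basis. B i)" for z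
    using onorm_componentwise[OF has_derivative_bounded_linear[OF der]]
    by (rule order_trans) (auto intro!: sum_mono B)
  have "norm (f z - f z') \<le> (\<Sum>i\<in>Basis. B i) * norm (z - z')" for z z'
    by (rule differentiable_bound[where S = UNIV and f' = ?D]) (use der on in auto)
  then show ?thesis
    using B by (intro exI[of _ "\<Sum>i\<in>Basis. B i"]) (auto intro: sum_nonneg)
qed

section \<open>Measurability, standing assumptions and the model\<close>

lemma flat_f_measurable [measurable]: "flat_f a b q p \<in> borel_measurable borel"
  unfolding flat_f_def flat_exp_def borel_prod[symmetric] by measurable

lemma zeta_integrand_measurable:
  assumes "f \<in> borel_measurable borel" "\<phi> \<in> borel_measurable borel"
  shows "zeta_integrand f \<phi> s \<in> borel_measurable borel"
  unfolding zeta_integrand_def using assms by measurable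

lemma indicator_Ioc_eq: "indicator {t<..r} u = (if t < u \<and> u \<le> r then 1 else 0)"
  by (simp add: indicator_def)

lemma has_bochner_integral_indicator_abs:
  fixes R :: real
  assumes "0 \<le> R"
  shows "has_bochner_integral lborel (\<lambda>y::real. indicator {0..R} \<bar>y\<bar> :: real) (2 * R)"
proof -
  have "((\<lambda>_. 1::real) has_integral R) {0..R}"
    using has_integral_const_real[of "1::real" 0 R] assms by simp
  from has_bochner_integral_even_HK[OF this] show ?thesis by simp
qed

text \<open>The properties of \<phi> on which the estimates rest. One constant \<open>C\<close> is
  both supremum bound and Lipschitz constant, so that all error terms share a factor;
  \<open>1 \<le> R\<close> keeps the cut-off |y| <= 1 of the model inside the square outside which
  \<phi> vanishes.\<close>

locale flat_zeta =
  fixes a b q :: nat and p R C :: real and \<phi> :: "real \<times> real \<Rightarrow> real"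
  assumes ab: "a < b" and q2: "2 \<le> q" and qb: "q \<le> b" and evq: "even q" and p0: "0 < p"
    and R1: "1 \<le> R" and cont: "continuous_on UNIV \<phi>"
    and bd: "\<bar>\<phi> z\<bar> \<le> C"
    and lip: "\<bar>\<phi> (x, y) - \<phi> (x', y')\<bar> \<le> C * (\<bar>x - x'\<bar> + \<bar>y - y'\<bar>)"
    and supp: "R < \<bar>x\<bar> \<or> R < \<bar>y\<bar> \<Longrightarrow> \<phi> (x, y) = 0"
begin

text \<open>The \<open>q\<close>-th root of \<open>flat_exp p x\<close>, except at \<open>x = 0\<close>, where it takes the value 1.\<close>

definition threshold :: "real \<Rightarrow> real"
  where "threshold x = exp (- 1 / (real q * \<bar>x\<bar> powr p))"

definition weight :: "real \<Rightarrow> real"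
  where "weight x = (1 + \<bar>x\<bar> powr (- real a / real b)) * indicator {0..R} \<bar>x\<bar>"

text \<open>With u = y/w(x), the first exponent is that of |y|^((b-q)s) at s = -1/b; it exceeds -1
  because q is positive. The second part is 1/|u| from the leading term times its relative error
  1/|u|.\<close>

definition kernel :: "real \<Rightarrow> real"
  where "kernel u = \<bar>u\<bar> powr (real q / real b - 1) * indicator {0..1} \<bar>u\<bar>
                   + \<bar>u\<bar> powr (-2) * indicator {1..} \<bar>u\<bar>"

text \<open>The cut-off at 1 instead of \<open>R\<close> makes the upper limit of the y-integral
  contribute 1^d = 1 for every d; the strip 1 < |y| <= R goes into the error.\<close>

definition model :: "real \<Rightarrow> real \<times> real \<Rightarrow> real"
  where "model s = (\<lambda>(x, y). \<bar>x\<bar> powr (real a * s) * \<bar>y\<bar> powr (real b * s) * indicator {threshold x<..1} \<bar>y\<bar>)"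

text \<open>A bound, uniform in \<open>s\<close>, for the error made by replacing the zeta integrand by \<open>model\<close>.\<close>

definition error :: "real \<times> real \<Rightarrow> real"
  where "error = (\<lambda>(x, y). C * weight x * (indicator {0..R} \<bar>y\<bar> + kernel (y / threshold x) / threshold x))"

lemma C_nonneg: "0 \<le> C" using bd[of "(0,0)"] by linarith

lemma two_le_b: "2 \<le> real b" using q2 qb by simp

lemma phi_measurable [measurable]: "\<phi> \<in> borel_measurable borel"
  using cont by (rule borel_measurable_continuous_onI)

lemma threshold_pos: "0 < threshold x" by (simp add: threshold_def)

lemma threshold_less_1: "x \<noteq> 0 \<Longrightarrow> threshold x < 1"
  using q2 by (simp add: threshold_def)

lemma threshold_power: "x \<noteq> 0 \<Longrightarrow> threshold x ^ q = flat_exp p x"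
  using q2 by (simp add: threshold_def flat_exp_def exp_of_nat_mult [symmetric])

lemma kernel_nonneg: "0 \<le> kernel u"
  by (simp add: kernel_def)

lemma weight_nonneg: "0 \<le> weight x"
  by (simp add: weight_def)

lemma error_nonneg: "0 \<le> error z"
  using C_nonneg threshold_pos kernel_nonneg weight_nonneg
  by (auto simp: error_def split_beta less_imp_le intro!: mult_nonneg_nonneg add_nonneg_nonneg divide_nonneg_nonneg)

section \<open>Pointwise comparison with the model\<close>

text \<open>The exponent as lies between -a/b and 0. For |x| <= 1 the most singular exponent
  dominates, for |x| > 1 the constant 1 does, so \<open>weight\<close> serves all \<open>s\<close>
  at once.\<close>

lemma powr_le_weight:
  assumes "x \<noteq> 0" "\<bar>x\<bar> \<le> R" "- 1 / real b \<le> s" "s \<le> 0"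
  shows "\<bar>x\<bar> powr (real a * s) \<le> weight x"
proof -
  have as: "- real a / real b \<le> real a * s"
    using mult_left_mono[OF assms(3), of "real a"] by simp
  have "\<bar>x\<bar> powr (real a * s) \<le> 1 + \<bar>x\<bar> powr (- real a / real b)"
  proof (cases "\<bar>x\<bar> \<le> 1")
    case True
    then show ?thesis using as assms powr_mono'[of "- real a / real b" "real a * s" "\<bar>x\<bar>"] by simp
  next
    case False
    then show ?thesis using assms powr_mono[of "real a * s" 0 "\<bar>x\<bar>"]
      by (simp add: mult_nonneg_nonpos add_increasing2)
  qed
  with assms show ?thesis by (simp add: weight_def)
qed

lemma abs_flat_f:
  assumes "x \<noteq> 0"
  shows "\<bar>flat_f a b q p (x, y)\<bar> = \<bar>x\<bar> ^ a * \<bar>y\<bar> ^ (b - q) * (\<bar>y\<bar> ^ q + threshold x ^ q)"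
proof -
  have "flat_f a b q p (x, y) = x ^ a * y ^ (b - q) * (\<bar>y\<bar> ^ q + threshold x ^ q)"
    using qb evq assms
    by (simp add: flat_f_def threshold_power power_even_abs algebra_simps flip: power_add)
  moreover have "0 \<le> \<bar>y\<bar> ^ q + threshold x ^ q"
    using threshold_pos[of x] by (simp add: add_nonneg_nonneg less_imp_le)
  ultimately show ?thesis
    by (simp add: abs_mult power_abs)
qed

lemma flat_f_powr:
  assumes "x \<noteq> 0" "y \<noteq> 0"
  shows "\<bar>flat_f a b q p (x, y)\<bar> powr s
    = \<bar>x\<bar> powr (real a * s) * \<bar>y\<bar> powr ((real b - real q) * s) * (\<bar>y\<bar> ^ q + threshold x ^ q) powr s"
proof -
  have "0 \<le> \<bar>y\<bar> ^ q + threshold x ^ q"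
    using threshold_pos[of x] by (simp add: add_nonneg_nonneg less_imp_le)
  then show ?thesis
    using assms qb unfolding abs_flat_f[OF assms(1)]
    by (simp add: powr_mult powr_powr of_nat_diff flip: powr_realpow)
qed

text \<open>Dividing the bracket by |y|^q leaves a factor close to 1 far above the curve |y| = w(x).
  Below the curve the undivided form is the useful one.\<close>

lemma flat_f_powr_factor:
  assumes "x \<noteq> 0" "y \<noteq> 0"
  shows "\<bar>flat_f a b q p (x, y)\<bar> powr s
    = \<bar>x\<bar> powr (real a * s) * \<bar>y\<bar> powr (real b * s) * (1 + (threshold x / \<bar>y\<bar>) ^ q) powr s"
proof -
  have "\<bar>y\<bar> ^ q + threshold x ^ q = \<bar>y\<bar> ^ q * (1 + (threshold x / \<bar>y\<bar>) ^ q)"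
    using assms by (simp add: field_simps)
  moreover have "0 \<le> 1 + (threshold x / \<bar>y\<bar>) ^ q"
    using threshold_pos[of x] by (simp add: add_nonneg_nonneg less_imp_le)
  moreover have "(\<bar>y\<bar> ^ q) powr s = \<bar>y\<bar> powr (real q * s)"
    using assms by (simp add: powr_powr flip: powr_realpow)
  ultimately have "(\<bar>y\<bar> ^ q + threshold x ^ q) powr s
      = \<bar>y\<bar> powr (real q * s) * (1 + (threshold x / \<bar>y\<bar>) ^ q) powr s"
    by (simp add: powr_mult)
  moreover have "\<bar>y\<bar> powr ((real b - real q) * s) * \<bar>y\<bar> powr (real q * s) = \<bar>y\<bar> powr (real b * s)"
    by (simp add: algebra_simps flip: powr_add)
  ultimately show ?thesis
    by (simp add: flat_f_powr[OF assms] mult.assoc flip: mult.assoc[of "\<bar>y\<bar> powr ((real b - real q) * s)"])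
qed

lemma flat_f_powr_le:
  assumes "x \<noteq> 0" "y \<noteq> 0" "-1 \<le> s" "s \<le> 0"
  shows "\<bar>flat_f a b q p (x, y)\<bar> powr s \<le> \<bar>x\<bar> powr (real a * s) * \<bar>y\<bar> powr (real b * s)"
  unfolding flat_f_powr_factor[OF assms(1,2)]
  using one_plus_powr_bounds(2)[OF assms(3,4), of "(threshold x / \<bar>y\<bar>) ^ q"] threshold_pos[of x]
  by (intro mult_left_le) (auto simp: less_imp_le)

text \<open>The last factor in \<open>flat_f_powr_factor\<close> differs from 1 by at most
  (w/|y|)^q, which is at most w/|y| because this ratio is at most 1. The first power suffices:
  multiplied by |y|^(bs) <= 1/|y| it gives w/y^2.\<close>

lemma flat_f_powr_diff_le:
  assumes "x \<noteq> 0" "y \<noteq> 0" "-1 \<le> s" "s \<le> 0" and y: "threshold x \<le> \<bar>y\<bar>"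
  shows "\<bar>\<bar>flat_f a b q p (x, y)\<bar> powr s - \<bar>x\<bar> powr (real a * s) * \<bar>y\<bar> powr (real b * s)\<bar>
    \<le> \<bar>x\<bar> powr (real a * s) * \<bar>y\<bar> powr (real b * s) * (threshold x / \<bar>y\<bar>)"
proof -
  define t where "t = (threshold x / \<bar>y\<bar>) ^ q"
  have r: "0 \<le> threshold x / \<bar>y\<bar>" "threshold x / \<bar>y\<bar> \<le> 1"
    using threshold_pos[of x] y assms(2) by (auto simp: less_imp_le)
  have t: "0 \<le> t" "t \<le> threshold x / \<bar>y\<bar>"
    using r power_decreasing[of 1 q "threshold x / \<bar>y\<bar>"] q2 by (auto simp: t_def)
  have "\<bar>(1 + t) powr s - 1\<bar> \<le> threshold x / \<bar>y\<bar>"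
    using one_plus_powr_bounds[OF assms(3,4) t(1)] t(2) by linarith
  moreover have "\<bar>flat_f a b q p (x, y)\<bar> powr s - \<bar>x\<bar> powr (real a * s) * \<bar>y\<bar> powr (real b * s)
     = \<bar>x\<bar> powr (real a * s) * \<bar>y\<bar> powr (real b * s) * ((1 + t) powr s - 1)"
    unfolding flat_f_powr_factor[OF assms(1,2)] t_def by (simp add: algebra_simps)
  ultimately show ?thesis
    by (simp add: abs_mult mult_left_mono del: times_divide_eq_right)
qed

text \<open>The bracket |y|^q + w^q is at least w^q, and a nonpositive power reverses this. Since
  |y| and w are below 1, the exponents of |y| and w may be replaced by their values at s = -1/b,
  namely q/b - 1 and -q/b; their sum is -1, which produces the form kernel(y/w)/w.\<close>

lemma flat_f_powr_le_inner:
  assumes "x \<noteq> 0" "y \<noteq> 0" "- 1 / real b \<le> s" "s \<le> 0" and y: "\<bar>y\<bar> \<le> threshold x"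
  shows "\<bar>flat_f a b q p (x, y)\<bar> powr s
    \<le> \<bar>x\<bar> powr (real a * s) * (kernel (y / threshold x) / threshold x)"
proof -
  let ?w = "threshold x" and ?c = "real q / real b"
  have w: "0 < ?w" "?w < 1" using threshold_pos threshold_less_1 assms by auto
  have "(\<bar>y\<bar> ^ q + ?w ^ q) powr s \<le> (?w ^ q) powr s"
    using assms w by (intro powr_mono2') auto
  also have "\<dots> = ?w powr (real q * s)"
    using w by (simp add: powr_powr flip: powr_realpow)
  also have "\<dots> \<le> ?w powr (- ?c)"
    using w mult_left_mono[OF assms(3), of "real q"] by (intro powr_mono') auto
  finally have 1: "(\<bar>y\<bar> ^ q + ?w ^ q) powr s \<le> ?w powr (- ?c)" .
  have "?c - 1 \<le> (real b - real q) * s"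
    using mult_left_mono[OF assms(3), of "real b - real q"] qb two_le_b by (simp add: field_simps)
  then have 2: "\<bar>y\<bar> powr ((real b - real q) * s) \<le> \<bar>y\<bar> powr (?c - 1)"
    using w y assms by (intro powr_mono') auto
  have "\<bar>y\<bar> powr (?c - 1) * ?w powr (- ?c) = (\<bar>y\<bar> / ?w) powr (?c - 1) / ?w"
    using w assms by (simp add: powr_divide powr_diff powr_minus field_simps)
  also have "\<dots> \<le> kernel (y / ?w) / ?w"
    using w y by (intro divide_right_mono) (auto simp: kernel_def abs_divide indicator_def)
  finally have 3: "\<bar>y\<bar> powr (?c - 1) * ?w powr (- ?c) \<le> kernel (y / ?w) / ?w" .
  have "\<bar>y\<bar> powr ((real b - real q) * s) * (\<bar>y\<bar> ^ q + ?w ^ q) powr s \<le> \<bar>y\<bar> powr (?c - 1) * ?w powr (- ?c)"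
    using 1 2 by (intro mult_mono) auto
  with 3 show ?thesis
    unfolding flat_f_powr[OF assms(1,2)] mult.assoc by (intro mult_left_mono) auto
qed

text \<open>Each range of |y| has its own error. Up to w(x) the model is absent and the kernel
  bounds the integrand; from there to 1 there are the relative error of |f|^s and the change from
  \<phi>(x,y) to \<phi>(x,0); from 1 to \<open>R\<close> the integrand is bounded in y; beyond,
  everything vanishes.\<close>

lemma integrand_minus_model_le:
  assumes "x \<noteq> 0" "y \<noteq> 0" and s: "- 1 / real b \<le> s" "s \<le> 0"
  shows "\<bar>\<bar>flat_f a b q p (x, y)\<bar> powr s * \<phi> (x, y) - model s (x, y) * \<phi> (x, 0)\<bar> \<le> error (x, y)"
proof (cases "\<bar>x\<bar> \<le> R")
  case False
  then have "\<phi> (x, y) = 0" "\<phi> (x, 0) = 0" using supp by auto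
  then show ?thesis using error_nonneg by simp
next
  case True
  let ?w = "threshold x" and ?A = "\<bar>flat_f a b q p (x, y)\<bar> powr s" and ?X = "\<bar>x\<bar> powr (real a * s)"
    and ?Y = "\<bar>y\<bar> powr (real b * s)"
  have w: "0 < ?w" "?w < 1" using threshold_pos threshold_less_1 assms by auto
  have XG: "?X \<le> weight x" using powr_le_weight True assms by blast
  have s1: "-1 \<le> s" using s two_le_b by (auto simp: field_simps intro: order_trans[of _ "- 1 / real b"])
  have K: "0 \<le> kernel (y / ?w) / ?w" using kernel_nonneg w by simp
  \<comment> \<open>The x-part of the bound is the same in all ranges, so only a y-part
    \<open>Z\<close> below that of \<open>error\<close> has to be supplied.\<close>
  have suff: ?thesis
    if "\<bar>?A * \<phi> (x, y) - model s (x, y) * \<phi> (x, 0)\<bar> \<le> C * ?X * Z"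
       "Z \<le> indicator {0..R} \<bar>y\<bar> + kernel (y / ?w) / ?w" "0 \<le> Z" for Z
  proof -
    have "C * ?X * Z \<le> C * weight x * (indicator {0..R} \<bar>y\<bar> + kernel (y / ?w) / ?w)"
      using that XG C_nonneg weight_nonneg[of x] by (intro mult_mono) auto
    then show ?thesis using that by (simp add: error_def)
  qed
  consider "\<bar>y\<bar> \<le> ?w" | "?w < \<bar>y\<bar>" "\<bar>y\<bar> \<le> 1" | "1 < \<bar>y\<bar>" "\<bar>y\<bar> \<le> R" | "R < \<bar>y\<bar>" by linarith
  then show ?thesis
  proof cases
    case 1
    have "\<bar>?A * \<phi> (x, y)\<bar> \<le> (?X * (kernel (y / ?w) / ?w)) * C"
      unfolding abs_mult using flat_f_powr_le_inner[OF assms 1] bd K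
      by (intro mult_mono mult_nonneg_nonneg) auto
    with 1 K show ?thesis
      by (intro suff[of "kernel (y / ?w) / ?w"]) (auto simp: model_def mult_ac)
  next
    case 2
    have "?Y \<le> \<bar>y\<bar> powr (-1)"
      using 2 assms two_le_b by (intro powr_mono') (auto simp: field_simps)
    then have Y: "?Y \<le> inverse \<bar>y\<bar>" using assms by (simp add: powr_minus)
    have "?Y * (?w / \<bar>y\<bar>) \<le> inverse \<bar>y\<bar> * (?w / \<bar>y\<bar>)"
      using Y w by (intro mult_right_mono) auto
    also have "\<dots> = (\<bar>y\<bar> / ?w) powr (-2) / ?w"
      using w assms by (simp add: powr_minus field_simps power2_eq_square flip: powr_realpow)
    also have "\<dots> \<le> kernel (y / ?w) / ?w"
      using w 2 by (intro divide_right_mono) (auto simp: kernel_def abs_divide indicator_def)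
    finally have k: "?Y * (?w / \<bar>y\<bar>) \<le> kernel (y / ?w) / ?w" .
    have "\<bar>?A - ?X * ?Y\<bar> \<le> ?X * ?Y * (?w / \<bar>y\<bar>)"
      using flat_f_powr_diff_le[OF assms(1,2) s1 s(2)] 2 by simp
    also have "\<dots> \<le> ?X * (kernel (y / ?w) / ?w)"
      unfolding mult.assoc using k by (intro mult_left_mono) auto
    finally have d: "\<bar>?A - ?X * ?Y\<bar> \<le> ?X * (kernel (y / ?w) / ?w)" .
    have d1: "\<bar>(?A - ?X * ?Y) * \<phi> (x, y)\<bar> \<le> (?X * (kernel (y / ?w) / ?w)) * C"
      unfolding abs_mult using d bd K by (intro mult_mono) auto
    \<comment> \<open>The Lipschitz bound C|y| cancels the singularity 1/|y| and leaves a constant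
      in y.\<close>
    have "\<bar>?X * ?Y * (\<phi> (x, y) - \<phi> (x, 0))\<bar> \<le> (?X * inverse \<bar>y\<bar>) * (C * \<bar>y\<bar>)"
      unfolding abs_mult using Y lip[of x y x 0] by (intro mult_mono) auto
    then have d2: "\<bar>?X * ?Y * (\<phi> (x, y) - \<phi> (x, 0))\<bar> \<le> C * ?X"
      using assms by (simp add: field_simps)
    have "?A * \<phi> (x, y) - ?X * ?Y * \<phi> (x, 0) = (?A - ?X * ?Y) * \<phi> (x, y) + ?X * ?Y * (\<phi> (x, y) - \<phi> (x, 0))"
      by (simp add: algebra_simps)
    then have "\<bar>?A * \<phi> (x, y) - ?X * ?Y * \<phi> (x, 0)\<bar>
        \<le> \<bar>(?A - ?X * ?Y) * \<phi> (x, y)\<bar> + \<bar>?X * ?Y * (\<phi> (x, y) - \<phi> (x, 0))\<bar>"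
      by (simp only: abs_triangle_ineq)
    also have "\<dots> \<le> (?X * (kernel (y / ?w) / ?w)) * C + C * ?X"
      by (rule add_mono[OF d1 d2])
    also have "\<dots> = C * ?X * (1 + kernel (y / ?w) / ?w)"
      by (simp add: algebra_simps)
    finally have "\<bar>?A * \<phi> (x, y) - ?X * ?Y * \<phi> (x, 0)\<bar> \<le> C * ?X * (1 + kernel (y / ?w) / ?w)" .
    with 2 R1 K show ?thesis
      by (intro suff[of "1 + kernel (y / ?w) / ?w"]) (auto simp: model_def)
  next
    case 3
    have "?Y \<le> 1" using 3 s two_le_b assms(2) powr_mono[of "real b * s" 0 "\<bar>y\<bar>"] by (simp add: mult_nonneg_nonpos)
    then have "?A \<le> ?X"
      using flat_f_powr_le[OF assms(1,2) s1 s(2)] mult_left_le[of ?Y ?X] by simp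
    then have "\<bar>?A * \<phi> (x, y)\<bar> \<le> ?X * C"
      unfolding abs_mult using bd by (intro mult_mono) auto
    with 3 K show ?thesis
      by (intro suff[of 1]) (auto simp: model_def mult_ac)
  next
    case 4
    with supp R1 error_nonneg show ?thesis by (simp add: model_def)
  qed
qed

section \<open>Integrability of the pieces and reduction to one variable\<close>

text \<open>The result of integrating \<open>model s (x, y) * \<phi> (x, 0)\<close> over y. As the
  error stays bounded, it alone decides the growth of the zeta function.\<close>

definition main :: "real \<Rightarrow> real \<Rightarrow> real"
  where "main s x = \<bar>x\<bar> powr (real a * s) * \<phi> (x, 0) *
    (2 * ((1 - threshold x powr (real b * s + 1)) / (real b * s + 1)))"

lemma threshold_measurable [measurable]: "threshold \<in> borel_measurable borel"
  unfolding threshold_def by measurable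

lemma kernel_measurable [measurable]: "kernel \<in> borel_measurable borel"
  unfolding kernel_def by measurable

lemma weight_measurable [measurable]: "weight \<in> borel_measurable borel"
  unfolding weight_def by measurable

lemma error_measurable [measurable]: "error \<in> borel_measurable borel"
  unfolding error_def borel_prod[symmetric] by measurable

lemma model_measurable [measurable]: "model s \<in> borel_measurable borel"
  unfolding model_def borel_prod[symmetric] indicator_Ioc_eq by measurable

lemma phi_x_measurable [measurable]: "(\<lambda>x. \<phi> (x, 0)) \<in> borel_measurable borel"
  using measurable_compose[OF _ phi_measurable, of "\<lambda>x. (x, 0)" borel] by simp

lemma phi_scaled_measurable [measurable]: "(\<lambda>x. \<phi> (e * x, 0)) \<in> borel_measurable borel"
  using measurable_compose[OF _ phi_x_measurable, of "\<lambda>x. e * x" borel] by simp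

lemma phi_fst_measurable [measurable]: "(\<lambda>z. \<phi> (fst z, 0)) \<in> borel_measurable borel"
  using measurable_compose[OF _ phi_x_measurable, of fst borel]
  by (simp add: borel_measurable_continuous_onI continuous_on_fst)

lemma main_measurable [measurable]: "main s \<in> borel_measurable borel"
  unfolding main_def by measurable

lemma integrable_kernel: "integrable lborel kernel"
proof -
  have "integrable lborel (\<lambda>y. \<bar>y\<bar> powr (real q / real b - 1) * indicator {0..1} \<bar>y\<bar> :: real)"
    using has_bochner_integral_abs_powr_le[of "real q / real b - 1" 1] q2 two_le_b
    by (auto simp: has_bochner_integral_iff)
  moreover have "integrable lborel (\<lambda>y. \<bar>y\<bar> powr (-2) * indicator {1..} \<bar>y\<bar> :: real)"
    using has_bochner_integral_abs_powr_ge[of "-2" 1] by (auto simp: has_bochner_integral_iff)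
  ultimately show ?thesis unfolding kernel_def[abs_def] by auto
qed

text \<open>The value is free of \<open>w\<close>, which is why the error stays integrable in x
  although w(x) tends to 0 at the origin.\<close>

lemma has_bochner_integral_kernel_scaled:
  assumes "0 < w"
  shows "has_bochner_integral lborel (\<lambda>y. kernel (y / w) / w) (integral\<^sup>L lborel kernel)"
proof -
  have "has_bochner_integral lborel kernel (integral\<^sup>L lborel kernel)"
    using integrable_kernel by (simp add: has_bochner_integral_iff)
  then have "has_bochner_integral lborel (\<lambda>y. kernel (y / w)) (w * integral\<^sup>L lborel kernel)"
    using lborel_has_bochner_integral_real_affine_iff[of "1 / w" kernel _ 0] assms
    by (simp add: divide_inverse mult.commute)
  from has_bochner_integral_divide_zero[OF this, of w] show ?thesis using assms by simp
qed

lemma minus_one_less_exponent: "- 1 < - real a / real b" using ab by (simp add: field_simps)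

lemma integrable_weight: "integrable lborel weight"
proof -
  have "integrable lborel (\<lambda>x. indicator {0..R} \<bar>x\<bar> + \<bar>x\<bar> powr (- real a / real b) * indicator {0..R} \<bar>x\<bar>)"
    using has_bochner_integral_indicator_abs[of R] R1
      has_bochner_integral_abs_powr_le[OF minus_one_less_exponent, of R] by (auto simp: has_bochner_integral_iff)
  then show ?thesis by (simp add: weight_def[abs_def] distrib_right)
qed

lemma integrable_error: "integrable lborel error"
proof (rule integrable_lborel_prodI)
  show "has_bochner_integral lborel (\<lambda>y. error (x, y)) (C * weight x * (2 * R + integral\<^sup>L lborel kernel))" for x
    unfolding error_def prod.case
    using has_bochner_integral_kernel_scaled[OF threshold_pos] has_bochner_integral_indicator_abs R1
    by (intro has_bochner_integral_mult_right has_bochner_integral_add) auto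
  show "integrable lborel (\<lambda>x. C * weight x * (2 * R + integral\<^sup>L lborel kernel))"
    using integrable_weight by auto
qed (auto simp: error_nonneg)

text \<open>The y-factor is kept as it stands because it is majorised in two ways: for fixed s >
  -1/b by dropping the lower cut-off, and uniformly in s by 1/|y| with the cut-off retained.\<close>

lemma model_bound:
  assumes "x \<noteq> 0" "- 1 / real b \<le> s" "s \<le> 0"
  shows "\<bar>model s (x, y) * \<phi> (x, 0)\<bar>
    \<le> C * weight x * (\<bar>y\<bar> powr (real b * s) * indicator {threshold x<..1} \<bar>y\<bar>)"
proof (cases "\<bar>x\<bar> \<le> R")
  case True
  define Z where "Z = \<bar>y\<bar> powr (real b * s) * indicator {threshold x<..1} \<bar>y\<bar>"
  have Z: "0 \<le> Z" by (simp add: Z_def)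
  have "\<bar>model s (x, y) * \<phi> (x, 0)\<bar> = (\<bar>x\<bar> powr (real a * s) * \<bar>\<phi> (x, 0)\<bar>) * Z"
    by (simp add: model_def Z_def abs_mult)
  also have "\<dots> \<le> (weight x * C) * Z"
    using powr_le_weight[of x s] True assms bd Z weight_nonneg by (intro mult_right_mono mult_mono) auto
  finally show ?thesis by (simp add: Z_def mult_ac)
next
  case False
  then show ?thesis using supp C_nonneg weight_nonneg by auto
qed

lemma integrable_model:
  assumes "- 1 / real b < s" "s \<le> 0"
  shows "integrable lborel (\<lambda>z. model s z * \<phi> (fst z, 0))"
proof (rule Bochner_Integration.integrable_bound)
  have bs: "-1 < real b * s" using assms two_le_b by (simp add: field_simps)
  let ?W = "\<lambda>(x, y). C * weight x * (\<bar>y\<bar> powr (real b * s) * indicator {0..1} \<bar>y\<bar>)"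
  show "integrable lborel ?W"
  proof (rule integrable_lborel_prodI)
    show "?W \<in> borel_measurable borel" unfolding borel_prod[symmetric] by measurable
    show "has_bochner_integral lborel (\<lambda>y. ?W (x, y)) (C * weight x * (2 * (1 powr (real b * s + 1) / (real b * s + 1))))" for x
      unfolding prod.case using bs
      by (intro has_bochner_integral_mult_right has_bochner_integral_abs_powr_le) auto
    show "integrable lborel (\<lambda>x. C * weight x * (2 * (1 powr (real b * s + 1) / (real b * s + 1))))"
      using integrable_weight by auto
  qed (use C_nonneg weight_nonneg in auto)
  show "AE z in lborel. norm (model s z * \<phi> (fst z, 0)) \<le> norm (?W z)"
    using AE_lborel_prod_nonzero
  proof eventually_elim
    case (elim z)
    obtain x y where z: "z = (x, y)" by force
    have "\<bar>model s (x, y) * \<phi> (x, 0)\<bar>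
        \<le> C * weight x * (\<bar>y\<bar> powr (real b * s) * indicator {threshold x<..1} \<bar>y\<bar>)"
      using model_bound[of x s y] elim assms z by auto
    also have "\<dots> \<le> C * weight x * (\<bar>y\<bar> powr (real b * s) * indicator {0..1} \<bar>y\<bar>)"
      using C_nonneg weight_nonneg by (intro mult_left_mono) (auto simp: indicator_def)
    finally show ?case using C_nonneg weight_nonneg z by (simp add: abs_mult)
  qed
qed auto

lemma integral_model:
  assumes "- 1 / real b < s" "s \<le> 0"
  shows "(\<integral>z. model s z * \<phi> (fst z, 0) \<partial>lborel) = (\<integral>x. main s x \<partial>lborel)"
proof (rule integral_lborel_prod[OF integrable_model[OF assms]])
  have bs: "-1 < real b * s" using assms two_le_b by (simp add: field_simps)
  fix x :: real assume x: "x \<noteq> 0"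
  have "has_bochner_integral lborel (\<lambda>y. \<bar>x\<bar> powr (real a * s) * \<phi> (x, 0) * (\<bar>y\<bar> powr (real b * s) * indicator {threshold x<..1} \<bar>y\<bar>)) (main s x)"
    unfolding main_def
    using has_bochner_integral_abs_powr_Ioc[OF bs threshold_pos, of x 1] threshold_less_1[OF x]
    by (intro has_bochner_integral_mult_right) auto
  then show "has_bochner_integral lborel (\<lambda>y. model s (x, y) * \<phi> (fst (x, y), 0)) (main s x)"
    by (simp add: model_def mult_ac)
qed auto

lemma zeta_integrand_minus_model_le:
  assumes "- 1 / real b \<le> s" "s \<le> 0"
  shows "AE z in lborel. \<bar>zeta_integrand (flat_f a b q p) \<phi> s z - model s z * \<phi> (fst z, 0)\<bar> \<le> error z"
  using AE_lborel_prod_nonzero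
  by eventually_elim (auto simp: zeta_integrand_def intro!: integrand_minus_model_le assms)

lemma zeta_measurable [measurable]: "zeta_integrand (flat_f a b q p) \<phi> s \<in> borel_measurable borel"
  by (rule zeta_integrand_measurable) measurable

lemma integrable_zeta:
  assumes "- 1 / real b < s" "s \<le> 0"
  shows "integrable lborel (zeta_integrand (flat_f a b q p) \<phi> s)"
proof -
  let ?D = "\<lambda>z. zeta_integrand (flat_f a b q p) \<phi> s z - model s z * \<phi> (fst z, 0)"
  have "integrable lborel ?D"
  proof (rule Bochner_Integration.integrable_bound[OF integrable_error])
    show "AE z in lborel. norm (?D z) \<le> norm (error z)"
      using zeta_integrand_minus_model_le[of s] assms by (simp add: error_nonneg)
  qed measurable
  from Bochner_Integration.integrable_add[OF this integrable_model[OF assms]] show ?thesis by simp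
qed

lemma local_zeta_minus_main_le:
  assumes "- 1 / real b < s" "s \<le> 0"
  shows "\<bar>local_zeta (flat_f a b q p) \<phi> s - (\<integral>x. main s x \<partial>lborel)\<bar> \<le> integral\<^sup>L lborel error"
proof -
  let ?D = "\<lambda>z. zeta_integrand (flat_f a b q p) \<phi> s z - model s z * \<phi> (fst z, 0)"
  have "local_zeta (flat_f a b q p) \<phi> s - (\<integral>x. main s x \<partial>lborel) = (\<integral>z. ?D z \<partial>lborel)"
    unfolding local_zeta_def integral_model[OF assms, symmetric]
    using integrable_zeta[OF assms] integrable_model[OF assms] by simp
  also have "\<bar>\<dots>\<bar> \<le> integral\<^sup>L lborel error"
    using integral_abs_bound[of lborel ?D]
      integral_mono_AE[of lborel "\<lambda>z. \<bar>?D z\<bar>" error] zeta_integrand_minus_model_le[of s]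
      integrable_zeta[OF assms] integrable_model[OF assms] integrable_error assms
    by (auto intro: order_trans)
  finally show ?thesis .
qed

section \<open>Convergence at s = -1/b for p < 1 - a/b\<close>

text \<open>Over w(x) < |y| <= 1 the function 1/|y| integrates to -2 log w(x) = (2/q)|x|^(-p).
  Against \<open>weight\<close> the worst exponent at 0 is -a/b - p, which exceeds -1 by
  assumption.\<close>

lemma integrable_dominator:
  assumes "p < 1 - real a / real b"
  shows "integrable lborel (\<lambda>(x, y). C * weight x * (inverse \<bar>y\<bar> * indicator {threshold x<..1} \<bar>y\<bar>))"
    (is "integrable lborel ?W")
proof (rule integrable_lborel_prodI)
  show "?W \<in> borel_measurable borel" unfolding borel_prod[symmetric] indicator_Ioc_eq by measurable
  fix x :: real assume x: "x \<noteq> 0"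
  have "2 * (ln 1 - ln (threshold x)) = 2 / real q * \<bar>x\<bar> powr (-p)"
    by (simp add: threshold_def powr_minus field_simps)
  then show "has_bochner_integral lborel (\<lambda>y. ?W (x, y)) (C * weight x * (2 / real q * \<bar>x\<bar> powr (-p)))"
    unfolding prod.case
    using has_bochner_integral_abs_inverse_Ioc[OF threshold_pos, of x 1] threshold_less_1[OF x]
    by (intro has_bochner_integral_mult_right) auto
next
  have p1: "- 1 < - p" using assms minus_one_less_exponent by (smt (verit) divide_nonneg_nonneg of_nat_0_le_iff)
  have p2: "- 1 < - real a / real b - p" using assms by auto
  have "integrable lborel (\<lambda>x. \<bar>x\<bar> powr (-p) * indicator {0..R} \<bar>x\<bar> + \<bar>x\<bar> powr (- real a / real b - p) * indicator {0..R} \<bar>x\<bar>)"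
    using has_bochner_integral_abs_powr_le[OF p1, of R] R1
      has_bochner_integral_abs_powr_le[OF p2, of R] by (auto simp: has_bochner_integral_iff)
  then have "integrable lborel (\<lambda>x. weight x * \<bar>x\<bar> powr (-p))"
    by (rule back_subst[of "integrable lborel"])
       (auto simp: weight_def fun_eq_iff algebra_simps powr_diff powr_minus divide_inverse)
  then have "integrable lborel (\<lambda>x. (C * 2 / real q) * (weight x * \<bar>x\<bar> powr (-p)))" by auto
  then show "integrable lborel (\<lambda>x. C * weight x * (2 / real q * \<bar>x\<bar> powr (-p)))"
    by (simp add: mult_ac)
qed (use C_nonneg weight_nonneg in auto)

text \<open>The same majorant is valid at s = -1/b and to its right. At the endpoint it gives
  integrability, to the right dominated convergence, so the constant B is the zeta integral at
  -1/b.\<close>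

lemma local_zeta_converges:
  assumes "p < 1 - real a / real b"
  shows "integrable lborel (zeta_integrand (flat_f a b q p) \<phi> (- 1 / real b))"
    and "((\<lambda>s. local_zeta (flat_f a b q p) \<phi> s) \<longlongrightarrow> local_zeta (flat_f a b q p) \<phi> (- 1 / real b)) (at_right (- 1 / real b))"
proof -
  let ?W = "\<lambda>(x, y). C * weight x * (inverse \<bar>y\<bar> * indicator {threshold x<..1} \<bar>y\<bar>)"
  let ?F = "zeta_integrand (flat_f a b q p) \<phi>"
  let ?V = "\<lambda>z. error z + ?W z"
  have V: "integrable lborel ?V" using integrable_dominator[OF assms] integrable_error by auto
  have bound: "AE z in lborel. \<bar>?F s z\<bar> \<le> ?V z" if s: "- 1 / real b \<le> s" "s \<le> 0" for s
    using AE_lborel_prod_nonzero zeta_integrand_minus_model_le[OF s]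
  proof eventually_elim
    case (elim z)
    obtain x y where z: "z = (x, y)" by force
    have "\<bar>model s (x, y) * \<phi> (x, 0)\<bar>
        \<le> C * weight x * (\<bar>y\<bar> powr (real b * s) * indicator {threshold x<..1} \<bar>y\<bar>)"
      using model_bound[of x s y] elim s z by auto
    also have "\<dots> \<le> C * weight x * (inverse \<bar>y\<bar> * indicator {threshold x<..1} \<bar>y\<bar>)"
    proof (cases "\<bar>y\<bar> \<le> 1")
      case True
      have "\<bar>y\<bar> powr (real b * s) \<le> \<bar>y\<bar> powr (-1)"
        using True elim s two_le_b z by (intro powr_mono') (auto simp: field_simps)
      then have "\<bar>y\<bar> powr (real b * s) \<le> inverse \<bar>y\<bar>" using elim z by (simp add: powr_minus)
      then show ?thesis
        using C_nonneg weight_nonneg by (intro mult_left_mono mult_right_mono) auto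
    qed auto
    finally have "\<bar>model s z * \<phi> (fst z, 0)\<bar> \<le> ?W z" by (simp add: z)
    with elim show ?case by linarith
  qed
  show "integrable lborel (?F (- 1 / real b))"
    by (rule Bochner_Integration.integrable_bound[OF V])
       (use bound[of "- 1 / real b"] error_nonneg C_nonneg weight_nonneg in \<open>auto intro: order_trans[OF _ abs_ge_self]\<close>)
  show "((\<lambda>s. local_zeta (flat_f a b q p) \<phi> s) \<longlongrightarrow> local_zeta (flat_f a b q p) \<phi> (- 1 / real b)) (at_right (- 1 / real b))"
    unfolding local_zeta_def
  proof (rule tendsto_integral_at_right[OF _ _ _ V])
    show "- 1 / real b < 0" using two_le_b by auto
    show "AE z in lborel. ((\<lambda>s. ?F s z) \<longlongrightarrow> ?F (- 1 / real b) z) (at_right (- 1 / real b))"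
    proof (intro always_eventually allI)
      fix z
      \<comment> \<open>Where f vanishes the integrand is 0 for every exponent because
        \<open>0 powr s = 0\<close>; elsewhere the power is continuous in its exponent.\<close>
      show "((\<lambda>s. ?F s z) \<longlongrightarrow> ?F (- 1 / real b) z) (at_right (- 1 / real b))"
        by (cases "flat_f a b q p z = 0") (auto simp: zeta_integrand_def intro!: tendsto_intros)
    qed
  qed (use bound in auto)
qed

text \<open>Off the axes f does not vanish, so a zero integral would make the set where \<phi> is
  positive null; but this set is open and contains the origin.\<close>

lemma local_zeta_pos:
  assumes int: "integrable lborel (zeta_integrand (flat_f a b q p) \<phi> s)"
    and nonneg: "\<And>z. 0 \<le> \<phi> z" and pos: "0 < \<phi> (0, 0)"
  shows "0 < local_zeta (flat_f a b q p) \<phi> s"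
proof (rule ccontr)
  have nn: "AE z in lborel. 0 \<le> zeta_integrand (flat_f a b q p) \<phi> s z"
    using nonneg by (simp add: zeta_integrand_def)
  assume "\<not> ?thesis"
  moreover have "0 \<le> local_zeta (flat_f a b q p) \<phi> s"
    unfolding local_zeta_def using nn by (rule integral_nonneg_AE)
  ultimately have "(\<integral>z. zeta_integrand (flat_f a b q p) \<phi> s z \<partial>lborel) = 0"
    by (simp add: local_zeta_def)
  then have "AE z in lborel. zeta_integrand (flat_f a b q p) \<phi> s z = 0"
    using integral_nonneg_eq_0_iff_AE[OF int] nn by simp
  then have ae: "AE z in lborel. z \<notin> {z. 0 < \<phi> z}"
    using AE_lborel_prod_nonzero
  proof eventually_elim
    case (elim z)
    obtain x y where z: "z = (x, y)" by force
    have "0 < \<bar>x\<bar> ^ a * \<bar>y\<bar> ^ (b - q) * (\<bar>y\<bar> ^ q + threshold x ^ q)"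
      using elim z threshold_pos[of x] by (simp add: add_nonneg_pos zero_less_mult_iff)
    then have "flat_f a b q p z \<noteq> 0"
      using abs_flat_f[of x y] elim z by auto
    then show ?case using elim by (simp add: zeta_integrand_def)
  qed
  have "open {z. 0 < \<phi> z}"
    using cont by (intro open_Collect_less) auto
  from not_AE_notin_open[OF this] ae pos show False by auto
qed

section \<open>Rescaling in x\<close>

definition \<alpha> :: real
  where "\<alpha> = real a / real b"

text \<open>This is \<open>1 - threshold t\<close>, the shape that 1 - w(x)^d takes on the rescaled
  line. It is free of d and vanishes at t = 0 by the convention for division by 0.\<close>

definition profile :: "real \<Rightarrow> real"
  where "profile t = 1 - exp (- 1 / (real q * \<bar>t\<bar> powr p))"

definition core :: "real \<Rightarrow> real \<Rightarrow> real"
  where "core s t = \<bar>t\<bar> powr (real a * s) * \<phi> ((real b * s + 1) powr (1 / p) * t, 0) * profile t"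

lemma core_measurable [measurable]: "core s \<in> borel_measurable borel"
  unfolding core_def profile_def by measurable

lemma divide_q_le: "0 \<le> u \<Longrightarrow> u / real q \<le> u"
  using divide_left_mono[of 1 "real q" u] q2 by simp

text \<open>With u = |t|^(-p)/q the profile is 1 - e^(-u). The last bound rests on u - u^2 <= 1 -
  e^(-u), from e^(-u) <= 1/(1 + u) <= 1 - u + u^2; then u <= |t|^(-p) removes q from the
  square.\<close>

lemma profile_bounds:
  "0 \<le> profile t" "profile t \<le> 1"
  "t \<noteq> 0 \<Longrightarrow> profile t \<le> \<bar>t\<bar> powr (- p) / real q"
  "t \<noteq> 0 \<Longrightarrow> \<bar>t\<bar> powr (- p) / real q - \<bar>t\<bar> powr (- 2 * p) \<le> profile t"
proof -
  let ?u = "\<bar>t\<bar> powr (- p) / real q"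
  have e: "profile t = 1 - exp (- ?u)"
    by (simp add: profile_def powr_minus field_simps)
  have u: "0 \<le> ?u" by simp
  show "0 \<le> profile t" "profile t \<le> 1" using u unfolding e by auto
  show "profile t \<le> ?u" using exp_ge_add_one_self[of "- ?u"] unfolding e by linarith
  have "exp (- ?u) \<le> 1 / (1 + ?u)"
    unfolding exp_minus inverse_eq_divide using exp_ge_add_one_self[of ?u] u
    by (intro divide_left_mono mult_pos_pos add_pos_nonneg) auto
  also have "\<dots> \<le> 1 - ?u + ?u\<^sup>2"
  proof -
    have "(1 - ?u + ?u\<^sup>2) * (1 + ?u) = 1 + ?u ^ 3"
      by (simp only: algebra_simps power2_eq_square power3_eq_cube)
    then have "1 \<le> (1 - ?u + ?u\<^sup>2) * (1 + ?u)" using u by simp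
    moreover have "0 < 1 + ?u" using u by linarith
    ultimately show ?thesis by (simp only: pos_divide_le_eq)
  qed
  also have "?u\<^sup>2 \<le> \<bar>t\<bar> powr (- 2 * p)"
  proof -
    have "\<bar>t\<bar> powr (- 2 * p) = (\<bar>t\<bar> powr (-p))\<^sup>2"
      by (simp add: power2_eq_square flip: powr_add)
    moreover have "?u \<le> \<bar>t\<bar> powr (- p)" by (rule divide_q_le) simp
    ultimately show ?thesis using u power_mono by fastforce
  qed
  finally show "?u - \<bar>t\<bar> powr (- 2 * p) \<le> profile t" unfolding e by linarith
qed

text \<open>The exponent collects 1/p from dx, as/p from |x|^(as) and -1 from the division by d; as
  = \<alpha>(d - 1) brings it to the stated form.\<close>

lemma integral_main_scaled:
  assumes "- 1 / real b < s"
  defines "d \<equiv> real b * s + 1"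
  shows "(\<integral>x. main s x \<partial>lborel) = 2 * d powr ((1 - \<alpha>) / p - 1 + \<alpha> / p * d) * (\<integral>t. core s t \<partial>lborel)"
proof -
  have d: "0 < d" using assms two_le_b by (simp add: field_simps)
  let ?e = "d powr (1 / p)"
  have e: "0 < ?e" using d by simp
  have m: "main s (?e * t) = 2 * (?e powr (real a * s) / d) * core s t" for t
  proof -
    have "\<bar>?e * t\<bar> powr p = d * \<bar>t\<bar> powr p"
      using d e p0 by (simp add: abs_mult powr_mult powr_powr)
    then have "threshold (?e * t) powr d = exp (d * (- 1 / (real q * (d * \<bar>t\<bar> powr p))))"
      by (simp add: threshold_def powr_def[of "exp _"])
    also have "\<dots> = exp (- 1 / (real q * \<bar>t\<bar> powr p))"
      using d by simp
    finally have "threshold (?e * t) powr d = exp (- 1 / (real q * \<bar>t\<bar> powr p))" .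
    then show ?thesis
      using e by (simp add: main_def core_def profile_def abs_mult powr_mult flip: d_def)
  qed
  have as: "real a * s = \<alpha> * (d - 1)" using two_le_b by (simp add: d_def \<alpha>_def)
  have "(\<integral>x. main s x \<partial>lborel) = ?e * (\<integral>t. main s (?e * t) \<partial>lborel)"
    using lborel_integral_real_affine[of ?e "main s" 0] e by simp
  also have "\<dots> = 2 * (?e * ?e powr (real a * s) / d) * (\<integral>t. core s t \<partial>lborel)"
    by (simp add: m)
  also have "?e * ?e powr (real a * s) / d = d powr (1 / p + real a * s / p - 1)"
    using d by (simp add: powr_powr powr_add powr_diff)
  also have "1 / p + real a * s / p - 1 = (1 - \<alpha>) / p - 1 + \<alpha> / p * d"
    unfolding as using p0 by (simp add: field_simps)
  finally show ?thesis .
qed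

lemma filterlim_pole_distance: "filterlim (\<lambda>s. real b * s + 1) (at_right 0) (at_right (- 1 / real b))"
proof -
  have "((\<lambda>s. real b * s + 1) \<longlongrightarrow> real b * (- 1 / real b) + 1) (at_right (- 1 / real b))"
    by (intro tendsto_intros)
  moreover have "\<forall>\<^sub>F s in at_right (- 1 / real b). 0 < real b * s + 1"
    using eventually_at_right_less[of "- 1 / real b"]
    by eventually_elim (use two_le_b in \<open>simp add: field_simps\<close>)
  ultimately show ?thesis
    using two_le_b by (auto simp: filterlim_at elim: eventually_mono)
qed

lemma tendsto_pole_distance_powr:
  assumes "0 < k"
  shows "((\<lambda>s. (real b * s + 1) powr k) \<longlongrightarrow> 0) (at_right (- 1 / real b))"
proof -
  have "((\<lambda>d::real. d powr k) \<longlongrightarrow> 0 powr k) (at_right 0)"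
    using assms by (intro tendsto_powr' tendsto_intros) (auto simp: eventually_at_right_field intro: exI[of _ 1])
  from filterlim_compose[OF this filterlim_pole_distance] show ?thesis by simp
qed

lemma eventually_near_pole: "c > - 1 / real b \<Longrightarrow> \<forall>\<^sub>F s in at_right (- 1 / real b). - 1 / real b < s \<and> s < c"
  using eventually_at_right_less[of "- 1 / real b"] eventually_at_right_field by blast

section \<open>The case p > 1 - a/b\<close>

definition limit_core :: "real \<Rightarrow> real"
  where "limit_core t = \<bar>t\<bar> powr (- \<alpha>) * profile t"

text \<open>At infinity \<open>limit_core\<close> decays like |t|^(-p-\<alpha>). The exponent chosen
  here is midway between -p-\<alpha> and -1: it is integrable when p + \<alpha> > 1 and leaves room
  for the drift \<alpha> d in as = -\<alpha> + \<alpha> d.\<close>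

definition core_dominator :: "real \<Rightarrow> real"
  where "core_dominator t = \<bar>t\<bar> powr (- \<alpha>) * indicator {0..1} \<bar>t\<bar>
    + \<bar>t\<bar> powr (- (p + \<alpha> + 1) / 2) * indicator {1..} \<bar>t\<bar>"

lemma limit_core_measurable [measurable]: "limit_core \<in> borel_measurable borel"
  unfolding limit_core_def profile_def by measurable

lemma alpha_less_1: "\<alpha> < 1" and alpha_nonneg: "0 \<le> \<alpha>"
  using ab by (auto simp: field_simps \<alpha>_def)

context
  assumes p1: "1 - \<alpha> < p"
begin

lemma integrable_core_dominator: "integrable lborel core_dominator"
proof -
  have "integrable lborel (\<lambda>y. \<bar>y\<bar> powr (-\<alpha>) * indicator {0..1} \<bar>y\<bar> :: real)"
    using has_bochner_integral_abs_powr_le[of "-\<alpha>" 1] alpha_less_1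
    by (auto simp: has_bochner_integral_iff)
  moreover have "integrable lborel (\<lambda>y. \<bar>y\<bar> powr (- (p + \<alpha> + 1) / 2) * indicator {1..} \<bar>y\<bar> :: real)"
    using has_bochner_integral_abs_powr_ge[of "- (p + \<alpha> + 1) / 2" 1] p1
    by (auto simp: has_bochner_integral_iff)
  ultimately show ?thesis unfolding core_dominator_def[abs_def] by auto
qed

lemma powr_profile_le_dominator:
  assumes t: "t \<noteq> 0" and e: "- \<alpha> \<le> e" "e \<le> (p - \<alpha> - 1) / 2"
  shows "\<bar>t\<bar> powr e * profile t \<le> core_dominator t"
proof (cases "\<bar>t\<bar> \<le> 1")
  case True
  have "\<bar>t\<bar> powr e * profile t \<le> \<bar>t\<bar> powr (- \<alpha>) * 1"
    using True t e profile_bounds by (intro mult_mono powr_mono') auto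
  then show ?thesis using True by (simp add: core_dominator_def add_increasing2)
next
  case False
  have "\<bar>t\<bar> powr e * profile t \<le> \<bar>t\<bar> powr ((p - \<alpha> - 1) / 2) * (\<bar>t\<bar> powr (- p) / real q)"
    using False t e profile_bounds by (intro mult_mono powr_mono) auto
  also have "\<dots> \<le> \<bar>t\<bar> powr ((p - \<alpha> - 1) / 2) * \<bar>t\<bar> powr (- p)"
    using divide_q_le by (intro mult_left_mono) auto
  also have "\<dots> = \<bar>t\<bar> powr ((p - \<alpha> - 1) / 2 + - p)"
    by (rule powr_add [symmetric])
  also have "(p - \<alpha> - 1) / 2 + - p = - (p + \<alpha> + 1) / 2" by (simp add: field_simps)
  finally show ?thesis using False by (simp add: core_dominator_def)
qed

lemma limit_core_nonneg: "0 \<le> limit_core t"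
  using profile_bounds by (simp add: limit_core_def)

lemma integrable_limit_core: "integrable lborel limit_core"
proof (rule Bochner_Integration.integrable_bound[OF integrable_core_dominator])
  show "AE t in lborel. norm (limit_core t) \<le> norm (core_dominator t)"
    using AE_lborel_singleton[of "0::real"]
  proof eventually_elim
    case (elim t)
    have "- \<alpha> \<le> (p - \<alpha> - 1) / 2" using p1 by (simp add: field_simps)
    from powr_profile_le_dominator[OF elim order.refl this] limit_core_nonneg[of t]
    show ?case by (simp add: limit_core_def)
  qed
qed measurable

lemma A_integrand_eq: "0 < t \<Longrightarrow> A_integrand a b q p t = limit_core t"
  by (simp add: A_integrand_def limit_core_def profile_def \<alpha>_def)

lemma set_integrable_A: "set_integrable lborel {0<..} (A_integrand a b q p)"
proof -
  have "integrable lborel (\<lambda>t. indicator {0<..} t *\<^sub>R limit_core t)"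
    by (intro integrable_mult_indicator integrable_limit_core) auto
  then show ?thesis
    unfolding set_integrable_def
    by (rule back_subst[of "integrable lborel"])
       (auto simp: fun_eq_iff A_integrand_eq indicator_def)
qed

lemma integral_limit_core: "(\<integral>t. limit_core t \<partial>lborel) = 2 * A_const a b q p"
proof -
  have "(\<integral>t. A_integrand a b q p t * indicator {0<..} t \<partial>lborel) = A_const a b q p"
    by (simp add: A_const_def set_lebesgue_integral_def mult.commute)
  with set_integrable_A
  have "has_bochner_integral lborel (\<lambda>t. A_integrand a b q p t * indicator {0<..} t) (A_const a b q p)"
    by (simp add: set_integrable_def has_bochner_integral_iff mult.commute)
  moreover have "{0<..} \<subseteq> {0::real..}" by auto
  moreover have "A_integrand a b q p \<in> borel_measurable borel"
    unfolding A_integrand_def[abs_def] by measurable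
  ultimately have hb: "has_bochner_integral lborel (\<lambda>t. A_integrand a b q p \<bar>t\<bar> * indicator {0<..} \<bar>t\<bar>) (2 * A_const a b q p)"
    by (intro has_bochner_integral_even) auto
  have ae: "AE t in lborel. A_integrand a b q p \<bar>t\<bar> * indicator {0<..} \<bar>t\<bar> = limit_core t"
    using AE_lborel_singleton[of "0::real"]
    by eventually_elim (auto simp: A_integrand_eq limit_core_def profile_def)
  have "has_bochner_integral lborel limit_core (2 * A_const a b q p)"
    by (rule has_bochner_integralI_AE[OF hb _ ae]) measurable
  then show ?thesis by (simp add: has_bochner_integral_iff)
qed

lemma A_const_pos: "0 < A_const a b q p"
proof (rule ccontr)
  have nn: "AE t in lborel. 0 \<le> limit_core t" using limit_core_nonneg by auto
  assume "\<not> ?thesis"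
  then have "(\<integral>t. limit_core t \<partial>lborel) = 0"
    using integral_nonneg_AE[OF nn] integral_limit_core by simp
  then have "AE t in lborel. limit_core t = 0"
    using integral_nonneg_eq_0_iff_AE[OF integrable_limit_core nn] by simp
  then have "AE t in lborel. t \<notin> {0::real<..}"
    by eventually_elim (use q2 in \<open>auto simp: limit_core_def profile_def\<close>)
  then show False using not_AE_notin_open[of "{0::real<..}"] by auto
qed

lemma core_tendsto:
  "((\<lambda>s. \<integral>t. core s t \<partial>lborel) \<longlongrightarrow> 2 * A_const a b q p * \<phi> (0, 0)) (at_right (- 1 / real b))"
proof -
  \<comment> \<open>For s below this bound d < (p + \<alpha> - 1)/2. Since \<alpha> d <= d, the
    exponent \<alpha> d - \<alpha> then stays below (p - \<alpha> - 1)/2, the largest that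
    \<open>powr_profile_le_dominator\<close> admits.\<close>
  let ?c = "min 0 (((p + \<alpha> - 1) / 2 - 1) / real b)"
  have "((\<lambda>s. \<integral>t. core s t \<partial>lborel) \<longlongrightarrow> (\<integral>t. limit_core t * \<phi> (0, 0) \<partial>lborel)) (at_right (- 1 / real b))"
  proof (rule tendsto_integral_at_right[where W = "\<lambda>t. C * core_dominator t"])
    show "- 1 / real b < ?c" using two_le_b p1 by (auto simp: field_simps)
    show "integrable lborel (\<lambda>t. C * core_dominator t)" using integrable_core_dominator by auto
    show "AE t in lborel. \<bar>core s t\<bar> \<le> C * core_dominator t" if s: "- 1 / real b < s" "s < ?c" for s
      using AE_lborel_singleton[of "0::real"]
    proof eventually_elim
      case (elim t)
      define d where "d = real b * s + 1"
      have d: "0 < d" "d < (p + \<alpha> - 1) / 2" using s two_le_b by (auto simp: d_def field_simps)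
      have as: "real a * s = \<alpha> * d - \<alpha>" using two_le_b by (simp add: d_def \<alpha>_def field_simps)
      have ad: "0 \<le> \<alpha> * d" "\<alpha> * d \<le> d"
        using mult_right_mono[of \<alpha> 1 d] d alpha_less_1 alpha_nonneg by auto
      have as': "- \<alpha> \<le> real a * s" "real a * s \<le> (p - \<alpha> - 1) / 2"
        using ad d unfolding as by argo+
      have "\<bar>core s t\<bar> = \<bar>\<phi> ((real b * s + 1) powr (1 / p) * t, 0)\<bar> * (\<bar>t\<bar> powr (real a * s) * profile t)"
        using profile_bounds(1)[of t] by (simp add: core_def abs_mult)
      also have "\<dots> \<le> C * core_dominator t"
        using elim as' C_nonneg profile_bounds(1)[of t]
        by (intro mult_mono bd powr_profile_le_dominator) auto
      finally show ?case .
    qed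
    show "AE t in lborel. ((\<lambda>s. core s t) \<longlongrightarrow> limit_core t * \<phi> (0, 0)) (at_right (- 1 / real b))"
      using AE_lborel_singleton[of "0::real"]
    proof eventually_elim
      case (elim t)
      have "((\<lambda>s. (real b * s + 1) powr (1 / p)) \<longlongrightarrow> 0) (at_right (- 1 / real b))"
        by (rule tendsto_pole_distance_powr) (use p0 in simp)
      then have "((\<lambda>s. ((real b * s + 1) powr (1 / p) * t, 0::real)) \<longlongrightarrow> (0 * t, 0)) (at_right (- 1 / real b))"
        by (rule tendsto_Pair[OF tendsto_mult_right tendsto_const])
      moreover have "isCont \<phi> (0, 0)" using cont by (simp add: continuous_on_eq_continuous_at)
      ultimately have "((\<lambda>s. \<phi> ((real b * s + 1) powr (1 / p) * t, 0)) \<longlongrightarrow> \<phi> (0, 0)) (at_right (- 1 / real b))"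
        using isCont_tendsto_compose[of "(0,0)" \<phi>] by simp
      then have "((\<lambda>s. core s t) \<longlongrightarrow> \<bar>t\<bar> powr (real a * (- 1 / real b)) * \<phi> (0, 0) * profile t) (at_right (- 1 / real b))"
        unfolding core_def using elim by (intro tendsto_mult tendsto_powr tendsto_const tendsto_ident_at) auto
      then show ?case by (simp add: limit_core_def \<alpha>_def mult_ac)
    qed
  qed measurable
  then show ?thesis by (simp add: integral_limit_core)
qed

lemma local_zeta_asymptotics_gt:
  "((\<lambda>s. (real b * s + 1) powr (1 - (1 - \<alpha>) / p) * local_zeta (flat_f a b q p) \<phi> s)
     \<longlongrightarrow> 4 * A_const a b q p * \<phi> (0, 0)) (at_right (- 1 / real b))"
proof (rule tendsto_mult_bounded_diff)
  let ?\<kappa> = "1 - (1 - \<alpha>) / p"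
  have k: "0 < ?\<kappa>" using p1 p0 by simp
  show "((\<lambda>s. (real b * s + 1) powr ?\<kappa>) \<longlongrightarrow> 0) (at_right (- 1 / real b))"
    using k by (rule tendsto_pole_distance_powr)
  show "\<forall>\<^sub>F s in at_right (- 1 / real b).
      \<bar>local_zeta (flat_f a b q p) \<phi> s - (\<integral>x. main s x \<partial>lborel)\<bar> \<le> integral\<^sup>L lborel error"
    using eventually_near_pole[of 0] two_le_b by (auto elim!: eventually_mono intro!: local_zeta_minus_main_le)
  have "((\<lambda>s. 2 * (real b * s + 1) powr (\<alpha> / p * (real b * s + 1)) * (\<integral>t. core s t \<partial>lborel))
      \<longlongrightarrow> 2 * 1 * (2 * A_const a b q p * \<phi> (0, 0))) (at_right (- 1 / real b))"
    by (intro tendsto_mult core_tendsto tendsto_const filterlim_compose[OF tendsto_powr_mult_at_right_0 filterlim_pole_distance])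
  moreover have "\<forall>\<^sub>F s in at_right (- 1 / real b).
      2 * (real b * s + 1) powr (\<alpha> / p * (real b * s + 1)) * (\<integral>t. core s t \<partial>lborel)
      = (real b * s + 1) powr ?\<kappa> * (\<integral>x. main s x \<partial>lborel)"
    using eventually_at_right_less[of "- 1 / real b"]
  proof eventually_elim
    case (elim s)
    \<comment> \<open>The normalising power cancels the main power of d; the factor d^(\<alpha>
      d/p), with limit 1, survives.\<close>
    have "(1 - \<alpha>) / p - 1 + \<alpha> / p * (real b * s + 1) = - ?\<kappa> + \<alpha> / p * (real b * s + 1)" by simp
    moreover have "0 < real b * s + 1" using elim two_le_b by (simp add: field_simps)
    ultimately show ?case
      unfolding integral_main_scaled[OF elim] by (simp only: powr_add powr_minus) simp
  qed
  ultimately show "((\<lambda>s. (real b * s + 1) powr ?\<kappa> * (\<integral>x. main s x \<partial>lborel))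
      \<longlongrightarrow> 4 * A_const a b q p * \<phi> (0, 0)) (at_right (- 1 / real b))"
    by (simp add: tendsto_cong mult.assoc)
qed

end

section \<open>The borderline case p = 1 - a/b\<close>

lemma pole_distance_bounds:
  assumes "- 1 / real b < s" "s < 0"
  shows "0 < real b * s + 1" "real b * s + 1 < 1"
proof -
  show "0 < real b * s + 1" using assms two_le_b by (simp add: field_simps)
  show "real b * s + 1 < 1" using mult_pos_neg[of "real b" s] assms two_le_b by simp
qed

context
  assumes p_eq: "p = 1 - \<alpha>"
begin

text \<open>Gives the rate at which |t|^p times the profile approaches 1/q. The factor |t|^p is what
  remains of |t|^(as) once 1/|t| and |t|^(\<alpha> d) are split off.\<close>

lemma powr_profile_bounds:
  assumes t: "t \<noteq> 0"
  shows "1 / real q - \<bar>t\<bar> powr (- p) \<le> \<bar>t\<bar> powr p * profile t" "\<bar>t\<bar> powr p * profile t \<le> 1 / real q"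
proof -
  have 1: "\<bar>t\<bar> powr p * \<bar>t\<bar> powr (- p) = 1" using t by (simp add: powr_minus)
  have 2: "\<bar>t\<bar> powr p * \<bar>t\<bar> powr (- 2 * p) = \<bar>t\<bar> powr (- p)"
    by (simp flip: powr_add)
  have "\<bar>t\<bar> powr p * (\<bar>t\<bar> powr (- p) / real q - \<bar>t\<bar> powr (- 2 * p)) = 1 / real q - \<bar>t\<bar> powr (- p)"
    using 1 2 by (simp add: right_diff_distrib)
  moreover have "\<bar>t\<bar> powr p * (\<bar>t\<bar> powr (- p) / real q) = 1 / real q" using 1 by simp
  ultimately show "1 / real q - \<bar>t\<bar> powr (- p) \<le> \<bar>t\<bar> powr p * profile t" "\<bar>t\<bar> powr p * profile t \<le> 1 / real q"
    using mult_left_mono[OF profile_bounds(4)[OF t], of "\<bar>t\<bar> powr p"]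
      mult_left_mono[OF profile_bounds(3)[OF t], of "\<bar>t\<bar> powr p"] by auto
qed

text \<open>Telescopes one factor at a time, in an order in which \<open>P\<close>, the factor
  without a fixed bound, occurs only as \<open>P - 1\<close>.\<close>

lemma abs_triple_product_diff_le:
  fixes P F h F0 h0 :: real
  assumes "\<bar>F\<bar> \<le> C" "\<bar>F0\<bar> \<le> C" "\<bar>h\<bar> \<le> 1"
  shows "\<bar>P * F * h - F0 * h0\<bar> \<le> C * \<bar>P - 1\<bar> + \<bar>F - F0\<bar> + C * \<bar>h - h0\<bar>"
proof -
  have e: "P * F * h - F0 * h0 = (P - 1) * F * h + (F - F0) * h + F0 * (h - h0)"
    by (simp add: algebra_simps)
  have "\<bar>(P - 1) * F * h\<bar> \<le> \<bar>P - 1\<bar> * C * 1"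
    unfolding abs_mult using assms C_nonneg by (intro mult_mono) auto
  moreover have "\<bar>(F - F0) * h\<bar> \<le> \<bar>F - F0\<bar> * 1"
    unfolding abs_mult using assms by (intro mult_mono) auto
  moreover have "\<bar>F0 * (h - h0)\<bar> \<le> C * \<bar>h - h0\<bar>"
    unfolding abs_mult using assms by (intro mult_mono) auto
  moreover have "\<bar>P * F * h - F0 * h0\<bar> \<le> \<bar>(P - 1) * F * h\<bar> + \<bar>(F - F0) * h\<bar> + \<bar>F0 * (h - h0)\<bar>"
    unfolding e by (rule order_trans[OF abs_triangle_ineq add_right_mono[OF abs_triangle_ineq]])
  ultimately show ?thesis by (simp add: mult.commute)
qed

text \<open>The four terms have separate causes: the region |t| <= 1; the change of |t|^(\<alpha> d)
  to 1, where \<omega> bounds this power on |t| <= R/\<epsilon>; the change of \<phi>(\<epsilon> t,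
  0) to \<phi>(0, 0), of order \<epsilon>|t|, together with the range 1/\<epsilon> < |t| <=
  R/\<epsilon>, where 1/|t| < \<epsilon>; and the change of |t|^p times the profile to 1/q.\<close>

lemma core_near_inverse:
  assumes s: "- 1 / real b < s" "s < 0" and t: "t \<noteq> 0"
  defines "d \<equiv> real b * s + 1"
  defines "\<epsilon> \<equiv> d powr (1 / p)"
  defines "\<omega> \<equiv> (R / \<epsilon>) powr (\<alpha> * d)"
  shows "\<bar>core s t - \<phi> (0, 0) / real q * (inverse \<bar>t\<bar> * indicator {1<..1 / \<epsilon>} \<bar>t\<bar>)\<bar>
    \<le> C * (\<bar>t\<bar> powr (- \<alpha>) * indicator {0..1} \<bar>t\<bar>
          + (\<omega> - 1) * (inverse \<bar>t\<bar> * indicator {1<..1 / \<epsilon>} \<bar>t\<bar>)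
          + \<omega> * \<epsilon> * indicator {0..R / \<epsilon>} \<bar>t\<bar>
          + \<bar>t\<bar> powr (- 1 - p) * indicator {1..} \<bar>t\<bar>)"
    (is "\<bar>_ - ?J\<bar> \<le> C * (?X1 + ?X2 + ?X3 + ?X4)")
proof -
  have d: "0 < d" "d < 1" using pole_distance_bounds[OF s] by (auto simp: d_def)
  have as: "real a * s = \<alpha> * d - \<alpha>" using two_le_b by (simp add: d_def \<alpha>_def field_simps)
  have \<epsilon>: "0 < \<epsilon>" "\<epsilon> < 1" using d p0 powr_less_mono2[of "1 / p" d 1] by (auto simp: \<epsilon>_def)
  have R\<epsilon>: "1 \<le> 1 / \<epsilon>" "1 / \<epsilon> \<le> R / \<epsilon>" using \<epsilon> R1 by (auto simp: field_simps)
  have ad: "0 \<le> \<alpha> * d" using d alpha_nonneg by simp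
  have \<omega>: "1 \<le> \<omega>" using R\<epsilon> ad by (auto simp: \<omega>_def intro!: ge_one_powr_ge_zero)
  define F where "F = \<phi> (\<epsilon> * t, 0)"
  define P where "P = \<bar>t\<bar> powr (\<alpha> * d)"
  define h where "h = \<bar>t\<bar> powr p * profile t"
  have core: "core s t = \<bar>t\<bar> powr (real a * s) * F * profile t"
    by (simp add: core_def F_def \<epsilon>_def d_def)
  have F: "\<bar>F\<bar> \<le> C" unfolding F_def by (rule bd)
  have X: "0 \<le> ?X1" "0 \<le> ?X2" "0 \<le> ?X3" "0 \<le> ?X4" using \<omega> \<epsilon> by auto
  have as_split: "\<bar>t\<bar> powr (real a * s) = inverse \<bar>t\<bar> * P * \<bar>t\<bar> powr p"
  proof -
    \<comment> \<open>Here p = 1 - \<alpha> produces the critical power 1/|t|, whose integral is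
      logarithmic.\<close>
    have "real a * s = - 1 + \<alpha> * d + p" using as p_eq by simp
    then show ?thesis unfolding P_def using t by (simp only: powr_add) (simp add: powr_minus)
  qed
  have core': "core s t = inverse \<bar>t\<bar> * (P * F * h)"
    unfolding core as_split h_def by simp
  have h: "0 \<le> h" "h \<le> 1"
    using powr_profile_bounds(2)[OF t] profile_bounds(1)[of t] divide_q_le[of 1] by (auto simp: h_def)
  consider "\<bar>t\<bar> \<le> 1" | "1 < \<bar>t\<bar>" "\<bar>t\<bar> \<le> 1 / \<epsilon>" | "1 / \<epsilon> < \<bar>t\<bar>" "\<bar>t\<bar> \<le> R / \<epsilon>" | "R / \<epsilon> < \<bar>t\<bar>"
    by linarith
  then show ?thesis
  proof cases
    case 1
    have "\<bar>t\<bar> powr (real a * s) \<le> \<bar>t\<bar> powr (- \<alpha>)"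
      using 1 t ad as by (intro powr_mono') auto
    then have "\<bar>core s t\<bar> \<le> \<bar>t\<bar> powr (- \<alpha>) * C * 1"
      unfolding core abs_mult using F profile_bounds(1,2)[of t] C_nonneg by (intro mult_mono) auto
    also have "\<dots> = C * ?X1" using 1 by simp
    also have "\<dots> \<le> C * (?X1 + ?X2 + ?X3 + ?X4)" using X C_nonneg by (intro mult_left_mono) auto
    finally show ?thesis using 1 by simp
  next
    case 2
    have P: "1 \<le> P" "P \<le> \<omega>"
      using 2 ad R\<epsilon> by (auto simp: P_def \<omega>_def intro!: ge_one_powr_ge_zero powr_mono2)
    have F0: "\<bar>\<phi> (0, 0)\<bar> \<le> C" by (rule bd)
    have FF: "\<bar>F - \<phi> (0, 0)\<bar> \<le> C * (\<epsilon> * \<bar>t\<bar>)"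
      using lip[of "\<epsilon> * t" 0 0 0] \<epsilon> by (simp add: F_def abs_mult)
    have hh: "\<bar>h - 1 / real q\<bar> \<le> \<bar>t\<bar> powr (- p)"
      using powr_profile_bounds[OF t] unfolding h_def abs_le_iff by (simp add: algebra_simps)
    have "\<bar>P * F * h - \<phi> (0, 0) * (1 / real q)\<bar>
        \<le> C * \<bar>P - 1\<bar> + \<bar>F - \<phi> (0, 0)\<bar> + C * \<bar>h - 1 / real q\<bar>"
      using F F0 h by (intro abs_triple_product_diff_le) auto
    also have "\<dots> \<le> C * (\<omega> - 1) + C * (\<epsilon> * \<bar>t\<bar>) + C * \<bar>t\<bar> powr (- p)"
      using P FF hh C_nonneg by (intro add_mono mult_left_mono) auto
    finally have m: "\<bar>P * F * h - \<phi> (0, 0) * (1 / real q)\<bar> \<le> C * (\<omega> - 1) + C * (\<epsilon> * \<bar>t\<bar>) + C * \<bar>t\<bar> powr (- p)" .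
    have J: "?J = inverse \<bar>t\<bar> * (\<phi> (0, 0) * (1 / real q))" using 2 by simp
    have "\<bar>core s t - ?J\<bar> = inverse \<bar>t\<bar> * \<bar>P * F * h - \<phi> (0, 0) * (1 / real q)\<bar>"
      unfolding core' J right_diff_distrib [symmetric] by (simp add: abs_mult)
    also have "\<dots> \<le> inverse \<bar>t\<bar> * (C * (\<omega> - 1) + C * (\<epsilon> * \<bar>t\<bar>) + C * \<bar>t\<bar> powr (- p))"
      using m by (intro mult_left_mono) auto
    also have "\<dots> = C * ((\<omega> - 1) * inverse \<bar>t\<bar> + \<epsilon> + \<bar>t\<bar> powr (- 1 - p))"
      using t by (simp add: field_simps powr_diff powr_minus)
    also have "\<dots> \<le> C * (?X1 + ?X2 + ?X3 + ?X4)"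
    proof (rule mult_left_mono[OF _ C_nonneg])
      have "1 * \<epsilon> \<le> \<omega> * \<epsilon>" using \<omega> \<epsilon> by (intro mult_right_mono) auto
      then show "(\<omega> - 1) * inverse \<bar>t\<bar> + \<epsilon> + \<bar>t\<bar> powr (- 1 - p) \<le> ?X1 + ?X2 + ?X3 + ?X4"
        using 2 R\<epsilon> X by simp
    qed
    finally show ?thesis .
  next
    case 3
    have P: "0 \<le> P" "P \<le> \<omega>"
      using 3 ad R\<epsilon> by (auto simp: P_def \<omega>_def intro!: powr_mono2)
    have "inverse \<bar>t\<bar> \<le> inverse (1 / \<epsilon>)" using 3 \<epsilon> by (intro le_imp_inverse_le) auto
    then have "\<bar>core s t\<bar> \<le> \<epsilon> * (\<omega> * C * 1)"
      unfolding core' abs_mult using P F h \<epsilon> \<omega> C_nonneg by (intro mult_mono) auto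
    also have "\<dots> = C * ?X3" using 3 by simp
    also have "\<dots> \<le> C * (?X1 + ?X2 + ?X3 + ?X4)" using X C_nonneg by (intro mult_left_mono) auto
    finally show ?thesis using 3 by simp
  next
    case 4
    then have "R < \<bar>\<epsilon> * t\<bar>" using \<epsilon> by (simp add: abs_mult field_simps)
    then have "F = 0" unfolding F_def using supp by blast
    then have z: "core s t = 0" "?J = 0" using 4 R\<epsilon> by (auto simp: core)
    show ?thesis unfolding z using X C_nonneg by (simp only: diff_self abs_zero mult_nonneg_nonneg add_nonneg_nonneg)
  qed
qed

text \<open>The third error term is \<epsilon> times a length 2R/\<epsilon>, so \<epsilon> cancels;
  the second carries |ln d|, but with the factor \<omega> - 1, which tends to 0 with d. The whole
  bound is thus of smaller order than |ln d|.\<close>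

lemma integral_core_bound:
  assumes s: "- 1 / real b < s" "s < 0"
  defines "d \<equiv> real b * s + 1"
  defines "\<omega> \<equiv> (R / d powr (1 / p)) powr (\<alpha> * d)"
  shows "\<bar>(\<integral>t. core s t \<partial>lborel) - 2 * \<phi> (0, 0) / (p * real q) * \<bar>ln d\<bar>\<bar>
    \<le> C * (2 / p + (\<omega> - 1) * (2 * \<bar>ln d\<bar> / p) + \<omega> * (2 * R) + 2 / p)"
proof -
  define \<epsilon> where "\<epsilon> = d powr (1 / p)"
  have d: "0 < d" "d < 1" using pole_distance_bounds[OF s] by (auto simp: d_def)
  have \<epsilon>: "0 < \<epsilon>" "\<epsilon> < 1" using d p0 powr_less_mono2[of "1 / p" d 1] by (auto simp: \<epsilon>_def)
  have ln\<epsilon>: "ln (1 / \<epsilon>) = \<bar>ln d\<bar> / p" using d by (simp add: \<epsilon>_def ln_div ln_powr)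
  let ?J = "\<lambda>t. inverse \<bar>t\<bar> * indicator {1<..1 / \<epsilon>} \<bar>t\<bar>"
  let ?B = "\<lambda>t. C * (\<bar>t\<bar> powr (- \<alpha>) * indicator {0..1} \<bar>t\<bar> + (\<omega> - 1) * ?J t
          + \<omega> * \<epsilon> * indicator {0..R / \<epsilon>} \<bar>t\<bar> + \<bar>t\<bar> powr (- 1 - p) * indicator {1..} \<bar>t\<bar>)"
  let ?D = "\<lambda>t. core s t - \<phi> (0, 0) / real q * ?J t"
  have J: "has_bochner_integral lborel ?J (2 * (\<bar>ln d\<bar> / p))"
    using has_bochner_integral_abs_inverse_Ioc[of 1 "1 / \<epsilon>"] \<epsilon> ln\<epsilon> by simp
  have B: "has_bochner_integral lborel ?B
     (C * (2 * (1 powr (- \<alpha> + 1) / (- \<alpha> + 1)) + (\<omega> - 1) * (2 * (\<bar>ln d\<bar> / p)) + \<omega> * \<epsilon> * (2 * (R / \<epsilon>))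
        + 2 * (- (1 powr (- 1 - p + 1)) / (- 1 - p + 1))))"
    using alpha_less_1 p0 \<epsilon> R1
    by (intro has_bochner_integral_mult_right has_bochner_integral_add J has_bochner_integral_abs_powr_le
        has_bochner_integral_abs_powr_ge has_bochner_integral_indicator_abs) auto
  have le: "AE t in lborel. \<bar>?D t\<bar> \<le> ?B t"
    using AE_lborel_singleton[of "0::real"]
    by eventually_elim (use core_near_inverse[OF s] in \<open>simp add: d_def \<epsilon>_def \<omega>_def\<close>)
  have Bi: "integrable lborel ?B" using B by (simp add: has_bochner_integral_iff)
  have [measurable]: "?J \<in> borel_measurable borel"
    using borel_measurable_has_bochner_integral[OF J] by simp
  have Di: "integrable lborel ?D"
    by (rule Bochner_Integration.integrable_bound[OF Bi])
       (use le in \<open>auto elim!: eventually_mono intro: order_trans[OF _ abs_ge_self]\<close>)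
  have Ji: "integrable lborel ?J" using J by (simp add: has_bochner_integral_iff)
  have "integrable lborel (\<lambda>t. ?D t + \<phi> (0, 0) / real q * ?J t)"
    by (intro Bochner_Integration.integrable_add Di integrable_mult_right Ji)
  then have "integrable lborel (core s)" by simp
  then have "(\<integral>t. ?D t \<partial>lborel) = (\<integral>t. core s t \<partial>lborel) - \<phi> (0, 0) / real q * (\<integral>t. ?J t \<partial>lborel)"
    using Ji by (subst Bochner_Integration.integral_diff) auto
  then have eq: "(\<integral>t. core s t \<partial>lborel) - 2 * \<phi> (0, 0) / (p * real q) * \<bar>ln d\<bar> = (\<integral>t. ?D t \<partial>lborel)"
    using J by (simp add: has_bochner_integral_iff field_simps)
  have "\<bar>(\<integral>t. core s t \<partial>lborel) - 2 * \<phi> (0, 0) / (p * real q) * \<bar>ln d\<bar>\<bar> \<le> (\<integral>t. \<bar>?D t\<bar> \<partial>lborel)"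
    unfolding eq by (rule integral_abs_bound)
  also have "\<dots> \<le> (\<integral>t. ?B t \<partial>lborel)"
    by (intro integral_mono_AE integrable_abs Di Bi le)
  also have "\<dots> = C * (2 / p + (\<omega> - 1) * (2 * \<bar>ln d\<bar> / p) + \<omega> * (2 * R) + 2 / p)"
  proof -
    have "- \<alpha> + 1 = p" "- 1 - p + 1 = - p" using p_eq by simp_all
    then show ?thesis
      unfolding has_bochner_integral_integral_eq[OF B] using \<epsilon> by simp
  qed
  finally show ?thesis .
qed

lemma core_log_tendsto:
  "((\<lambda>s. inverse \<bar>ln (real b * s + 1)\<bar> * (\<integral>t. core s t \<partial>lborel)) \<longlongrightarrow> 2 * \<phi> (0, 0) / (p * real q))
     (at_right (- 1 / real b))"
proof -
  let ?F = "at_right (- 1 / real b)"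
  define \<omega> where "\<omega> = (\<lambda>d. (R / d powr (1 / p)) powr (\<alpha> * d))"
  define L where "L = (\<lambda>d. inverse \<bar>ln d\<bar> :: real)"
  have L0: "(L \<longlongrightarrow> 0) (at_right 0)"
    unfolding L_def by (rule tendsto_inverse_abs_ln_at_right_0)
  \<comment> \<open>The logarithm of \<omega> is \<alpha> d (ln R - (ln d)/p), and d ln d tends to
    0.\<close>
  have \<omega>1: "(\<omega> \<longlongrightarrow> 1) (at_right 0)"
  proof -
    have "((\<lambda>d. exp (\<alpha> * (d * ln R - d * ln d / p))) \<longlongrightarrow> exp (\<alpha> * (0 * ln R - 0 / p))) (at_right 0)"
      using p0 by (intro tendsto_intros tendsto_mult_ln_at_right_0) auto
    moreover have "\<forall>\<^sub>F d in at_right 0. exp (\<alpha> * (d * ln R - d * ln d / p)) = \<omega> d"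
      using eventually_at_right_less[of 0]
      by eventually_elim (use R1 p0 in \<open>simp add: \<omega>_def powr_def ln_div algebra_simps\<close>)
    ultimately show ?thesis by (simp add: tendsto_cong)
  qed
  \<comment> \<open>The bound of \<open>integral_core_bound\<close> divided by |ln d|, where the
    second term has lost its logarithm.\<close>
  have lim: "((\<lambda>d. C * (2 / p * L d + (\<omega> d - 1) * (2 / p) + \<omega> d * (2 * R) * L d + 2 / p * L d)) \<longlongrightarrow>
      C * (2 / p * 0 + (1 - 1) * (2 / p) + 1 * (2 * R) * 0 + 2 / p * 0)) (at_right 0)"
    by (intro tendsto_intros L0 \<omega>1)
  have "((\<lambda>s. inverse \<bar>ln (real b * s + 1)\<bar> * (\<integral>t. core s t \<partial>lborel) - 2 * \<phi> (0, 0) / (p * real q)) \<longlongrightarrow> 0) ?F"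
  proof (rule Lim_null_comparison)
    show "((\<lambda>s. (\<lambda>d. C * (2 / p * L d + (\<omega> d - 1) * (2 / p) + \<omega> d * (2 * R) * L d + 2 / p * L d)) (real b * s + 1)) \<longlongrightarrow> 0) ?F"
      using filterlim_compose[OF lim filterlim_pole_distance] by simp
    have "\<forall>\<^sub>F s in ?F. - 1 / real b < s \<and> s < 0" using eventually_near_pole[of 0] two_le_b by simp
    then show "\<forall>\<^sub>F s in ?F. norm (inverse \<bar>ln (real b * s + 1)\<bar> * (\<integral>t. core s t \<partial>lborel) - 2 * \<phi> (0, 0) / (p * real q))
      \<le> (\<lambda>d. C * (2 / p * L d + (\<omega> d - 1) * (2 / p) + \<omega> d * (2 * R) * L d + 2 / p * L d)) (real b * s + 1)"
    proof eventually_elim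
      case (elim s)
      define d where "d = real b * s + 1"
      define N where "N = (\<integral>t. core s t \<partial>lborel)"
      define c where "c = 2 * \<phi> (0, 0) / (p * real q)"
      have d: "0 < d" "d < 1" using pole_distance_bounds[of s] elim by (auto simp: d_def)
      have l: "0 < \<bar>ln d\<bar>" using d by simp
      then have L: "L d * \<bar>ln d\<bar> = 1" "0 < L d" by (auto simp: L_def)
      have "\<bar>L d * N - c\<bar> = L d * \<bar>N - c * \<bar>ln d\<bar>\<bar>"
      proof -
        have "L d * N - c = L d * (N - c * \<bar>ln d\<bar>)"
          using L(1) by (simp add: right_diff_distrib mult.left_commute[of "L d" c])
        then show ?thesis using L(2) by (simp add: abs_mult)
      qed
      also have "\<dots> \<le> L d * (C * (2 / p + (\<omega> d - 1) * (2 * \<bar>ln d\<bar> / p) + \<omega> d * (2 * R) + 2 / p))"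
        using integral_core_bound[of s] elim L(2)
        by (intro mult_left_mono) (auto simp: N_def c_def d_def \<omega>_def)
      also have "\<dots> = C * (2 / p * L d + (\<omega> d - 1) * (2 / p) * (L d * \<bar>ln d\<bar>) + \<omega> d * (2 * R) * L d + 2 / p * L d)"
        by (simp add: algebra_simps)
      finally show ?case unfolding L(1) by (simp add: L_def N_def c_def d_def)
    qed
  qed
  from tendsto_add[OF this tendsto_const[of "2 * \<phi> (0, 0) / (p * real q)"]] show ?thesis by simp
qed

lemma local_zeta_asymptotics_eq:
  "((\<lambda>s. inverse \<bar>ln (real b * s + 1)\<bar> * local_zeta (flat_f a b q p) \<phi> s)
     \<longlongrightarrow> 4 / (p * real q) * \<phi> (0, 0)) (at_right (- 1 / real b))"
proof (rule tendsto_mult_bounded_diff)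
  from filterlim_compose[OF tendsto_inverse_abs_ln_at_right_0 filterlim_pole_distance]
  show "((\<lambda>s. inverse \<bar>ln (real b * s + 1)\<bar>) \<longlongrightarrow> 0) (at_right (- 1 / real b))" .
  show "\<forall>\<^sub>F s in at_right (- 1 / real b).
      \<bar>local_zeta (flat_f a b q p) \<phi> s - (\<integral>x. main s x \<partial>lborel)\<bar> \<le> integral\<^sup>L lborel error"
    using eventually_near_pole[of 0] two_le_b by (auto elim!: eventually_mono intro!: local_zeta_minus_main_le)
  have "((\<lambda>s. 2 * (real b * s + 1) powr (\<alpha> / p * (real b * s + 1)) * (inverse \<bar>ln (real b * s + 1)\<bar> * (\<integral>t. core s t \<partial>lborel)))
      \<longlongrightarrow> 2 * 1 * (2 * \<phi> (0, 0) / (p * real q))) (at_right (- 1 / real b))"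
    by (intro tendsto_mult core_log_tendsto tendsto_const filterlim_compose[OF tendsto_powr_mult_at_right_0 filterlim_pole_distance])
  moreover have "\<forall>\<^sub>F s in at_right (- 1 / real b).
      2 * (real b * s + 1) powr (\<alpha> / p * (real b * s + 1)) * (inverse \<bar>ln (real b * s + 1)\<bar> * (\<integral>t. core s t \<partial>lborel))
      = inverse \<bar>ln (real b * s + 1)\<bar> * (\<integral>x. main s x \<partial>lborel)"
    using eventually_at_right_less[of "- 1 / real b"]
  proof eventually_elim
    case (elim s)
    \<comment> \<open>For p = 1 - \<alpha> the constant part of the exponent is 0, so no pole is
      left in the prefactor and the growth is purely logarithmic.\<close>
    have "(1 - \<alpha>) / p - 1 + \<alpha> / p * (real b * s + 1) = \<alpha> / p * (real b * s + 1)"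
      using p_eq p0 by simp
    then show ?case
      unfolding integral_main_scaled[OF elim] by (simp only: mult_ac)
  qed
  ultimately have "((\<lambda>s. inverse \<bar>ln (real b * s + 1)\<bar> * (\<integral>x. main s x \<partial>lborel))
      \<longlongrightarrow> 2 * 1 * (2 * \<phi> (0, 0) / (p * real q))) (at_right (- 1 / real b))"
    by (rule Lim_transform_eventually)
  then show "((\<lambda>s. inverse \<bar>ln (real b * s + 1)\<bar> * (\<integral>x. main s x \<partial>lborel))
      \<longlongrightarrow> 4 / (p * real q) * \<phi> (0, 0)) (at_right (- 1 / real b))"
    by simp
qed

end

end

section \<open>From smooth test functions to the conclusion\<close>

lemma flat_zeta_exists:
  fixes \<phi> :: "real \<times> real \<Rightarrow> real"
  assumes "a < b" "2 \<le> q" "q \<le> b" "even q" "0 < p"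
    and smooth: "Cinfinity \<phi>" and K: "compact (func_support \<phi>)"
  shows "\<exists>R C. flat_zeta a b q p R C \<phi>"
proof -
  have Ck: "Ck k \<phi>" for k using smooth by (simp add: Cinfinity_def)
  have cont: "continuous_on UNIV \<phi>" using Ck[of 0] by simp
  obtain B where B: "0 \<le> B" "\<And>z. \<bar>\<phi> z\<bar> \<le> B"
    using continuous_zero_outside_compact_bounded[OF cont K] func_support_zero by blast
  obtain L where L: "0 \<le> L" "\<And>z z'. \<bar>\<phi> z - \<phi> z'\<bar> \<le> L * norm (z - z')"
    using C1_compact_support_Lipschitz[OF Ck K] by blast
  obtain r where r: "\<And>z. z \<in> func_support \<phi> \<Longrightarrow> norm z \<le> r"
    using compact_imp_bounded[OF K] by (auto simp: bounded_iff)
  \<comment> \<open>The maximum with 1 secures \<open>1 \<le> R\<close>, and \<open>max B L\<close>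
    merges the supremum bound with the Lipschitz constant.\<close>
  have "flat_zeta a b q p (max r 1) (max B L) \<phi>"
  proof
    show "\<bar>\<phi> z\<bar> \<le> max B L" for z using B(2)[of z] by linarith
    show "\<bar>\<phi> (x, y) - \<phi> (x', y')\<bar> \<le> max B L * (\<bar>x - x'\<bar> + \<bar>y - y'\<bar>)" for x y x' y'
    proof -
      have "\<bar>\<phi> (x, y) - \<phi> (x', y')\<bar> \<le> L * norm (x - x', y - y')"
        using L(2)[of "(x, y)" "(x', y')"] by simp
      also have "\<dots> \<le> max B L * (\<bar>x - x'\<bar> + \<bar>y - y'\<bar>)"
        using norm_Pair_le[of "x - x'" "y - y'"] L(1) by (intro mult_mono) auto
      finally show ?thesis .
    qed
    show "\<phi> (x, y) = 0" if "max r 1 < \<bar>x\<bar> \<or> max r 1 < \<bar>y\<bar>" for x y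
    proof (rule func_support_zero[of "(x, y)" \<phi>], rule notI)
      assume "(x, y) \<in> func_support \<phi>"
      from r[OF this] norm_fst_le[of x y] norm_snd_le[of y x] that show False by auto
    qed
  qed (use assms cont in auto)
  then show ?thesis by blast
qed

theorem theorem2p1:
  fixes a b q :: nat and p :: real
    and U :: "(real \<times> real) set" and \<phi> :: "real \<times> real \<Rightarrow> real"
  assumes "a < b" and "2 \<le> b" and "1 \<le> q" and "q \<le> b" and "0 < p"
    and "open U" and "(0, 0) \<in> U"
    and "Cinfinity \<phi>" and "compact (func_support \<phi>)" and "func_support \<phi> \<subseteq> U"
    and "even q"
  shows
    "(\<forall>\<sigma>\<in>{- 1 / real b <..< 0}. integrable lborel (zeta_integrand (flat_f a b q p) \<phi> \<sigma>))
   \<and> (p > 1 - real a / real b \<longrightarrow>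
        set_integrable lborel {0<..} (A_integrand a b q p)
      \<and> 0 < A_const a b q p
      \<and> ((\<lambda>\<sigma>. (real b * \<sigma> + 1) powr (1 - (1 - real a / real b) / p)
               * local_zeta (flat_f a b q p) \<phi> \<sigma>)
          \<longlongrightarrow> 4 * A_const a b q p * \<phi> (0, 0)) (at_right (- 1 / real b)))
   \<and> (p = 1 - real a / real b \<longrightarrow>
        ((\<lambda>\<sigma>. inverse \<bar>ln (real b * \<sigma> + 1)\<bar> * local_zeta (flat_f a b q p) \<phi> \<sigma>)
          \<longlongrightarrow> 4 / (p * real q) * \<phi> (0, 0)) (at_right (- 1 / real b)))
   \<and> (p < 1 - real a / real b \<longrightarrow>
        (\<exists>B. ((\<lambda>\<sigma>. local_zeta (flat_f a b q p) \<phi> \<sigma>) \<longlongrightarrow> B) (at_right (- 1 / real b))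
           \<and> (\<phi> (0, 0) > 0 \<and> (\<forall>z\<in>U. \<phi> z \<ge> 0) \<longrightarrow> B > 0)))"
proof -
  have "2 \<le> q" using \<open>1 \<le> q\<close> \<open>even q\<close> by (cases "q = 1") auto
  then obtain R C where "flat_zeta a b q p R C \<phi>"
    using flat_zeta_exists[OF assms(1) _ assms(4,11,5,8,9)] by blast
  then interpret flat_zeta a b q p R C \<phi> .
  \<comment> \<open>\<phi> vanishes outside \<open>U\<close>, which contains the support, so its
    sign on \<open>U\<close> gives the sign on the whole plane that \<open>local_zeta_pos\<close>
    asks for.\<close>
  have nonneg: "0 \<le> \<phi> z" if "\<forall>z\<in>U. 0 \<le> \<phi> z" for z
    using that func_support_zero[of z \<phi>] assms(10) by (cases "z \<in> func_support \<phi>") auto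
  show ?thesis
  proof (intro conjI impI ballI)
    show "integrable lborel (zeta_integrand (flat_f a b q p) \<phi> \<sigma>)" if "\<sigma> \<in> {- 1 / real b <..< 0}" for \<sigma>
      using that by (intro integrable_zeta) auto
  next
    assume "1 - real a / real b < p"
    then have p: "1 - \<alpha> < p" by (simp add: \<alpha>_def)
    show "set_integrable lborel {0<..} (A_integrand a b q p)" "0 < A_const a b q p"
      using set_integrable_A[OF p] A_const_pos[OF p] by auto
    show "((\<lambda>\<sigma>. (real b * \<sigma> + 1) powr (1 - (1 - real a / real b) / p) * local_zeta (flat_f a b q p) \<phi> \<sigma>)
          \<longlongrightarrow> 4 * A_const a b q p * \<phi> (0, 0)) (at_right (- 1 / real b))"
      using local_zeta_asymptotics_gt[OF p] by (simp only: \<alpha>_def)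
  next
    assume "p = 1 - real a / real b"
    then show "((\<lambda>\<sigma>. inverse \<bar>ln (real b * \<sigma> + 1)\<bar> * local_zeta (flat_f a b q p) \<phi> \<sigma>)
          \<longlongrightarrow> 4 / (p * real q) * \<phi> (0, 0)) (at_right (- 1 / real b))"
      by (intro local_zeta_asymptotics_eq) (simp add: \<alpha>_def)
  next
    assume p: "p < 1 - real a / real b"
    show "\<exists>B. ((\<lambda>\<sigma>. local_zeta (flat_f a b q p) \<phi> \<sigma>) \<longlongrightarrow> B) (at_right (- 1 / real b))
           \<and> (\<phi> (0, 0) > 0 \<and> (\<forall>z\<in>U. \<phi> z \<ge> 0) \<longrightarrow> B > 0)"
      using local_zeta_converges[OF p] local_zeta_pos[OF local_zeta_converges(1)[OF p]] nonneg by blast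
  qed
qed

end
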